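(* Let $(\mathcal D_n)_{n\in\mathbb N}$, $\mathcal D_n=(\phi^n_\omega:\omega\in\Omega_n)$, be an asymptotically stable family of frames of $\mathbb R^{I_n}$, and let $(\epsilon_n)_{n\in\mathbb N}$ be a sequence of random vectors in $\mathbb R^{I_n}$ having independent $N(0,1)$-distributed entries. Then the sequence of maxima $\max\{\langle\phi_\omega^n,\epsilon_n\rangle:\omega\in\Omega_n\}$ is of Gumbel type with normalization constants $$a(N,|\Omega_n|):=\frac1{\sqrt{2\log|\Omega_n|}},\qquad b(N,|\Omega_n|):=\sqrt{2\log|\Omega_n|}-\frac{\log\log|\Omega_n|+\log(4\pi)}{2\sqrt{2\log|\Omega_n|}},$$ that is, for every $z\in\mathbb R$, $\lim_{n\to\infty}\mathbf P\{\max_{\omega\in\Omega_n}\langle\phi_\omega^n,\epsilon_n\rangle\le a(N,|\Omega_n|)z+b(N,|\Omega_n|)\}=\exp(-e^{-z})$.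
   Context: Fix $d\in\mathbb N$; $I_n=\{0,\dots,n-1\}^d$, and $\mathbb R^{I_n}$ carries the Euclidean inner product $\langle\cdot,\cdot\rangle$ and norm $\|\cdot\|$. For each $n$, $\mathcal D_n=(\phi_\omega^n:\omega\in\Omega_n)$, with $\Omega_n$ a finite index set, is a frame of $\mathbb R^{I_n}$: there are constants $0<a_n\le b_n<\infty$ with $a_n\|u\|^2\le\sum_{\omega\in\Omega_n}|\langle\phi_\omega^n,u\rangle|^2\le b_n\|u\|^2$ for all $u\in\mathbb R^{I_n}$; the frame bounds $a_n,b_n$ are the largest, respectively smallest, such constants. A family of frames $(\mathcal D_n)_n$ with normalized elements ($\|\phi_\omega^n\|=1$ for all $\omega\in\Omega_n$) is called asymptotically stable if (i) for some $\rho\in(0,1)$, $|\{(\omega,\omega')\in\Omega_n^2:\omega\ne\omega',\ |\langle\phi_\omega^n,\phi_{\omega'}^n\rangle|\ge\rho\}|=o\big(|\Omega_n|/\sqrt{\log|\Omega_n|}\big)$ as $n\to\infty$; and (ii) $\sup_n b_n<\infty$. A sequence $(M_n)$ of real random variables is of Gumbel type with normalizing sequences $(a_n)$, $(b_n)$ if $\mathbf P\{M_n\le a_nz+b_n\}\to\exp(-e^{-z})$ for all $z\in\mathbb R$. *)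

theory Defs
  imports "HOL-Probability.Probability" "HOL-Library.Landau_Symbols"
begin

definition grid :: "nat \<Rightarrow> nat \<Rightarrow> (nat \<Rightarrow> nat) set" where
  "grid d n = {..<d} \<rightarrow>\<^sub>E {..<n}"

(* For a finite set I, a vector of R^I is represented by any function agreeing with it on I:
   dot I and L2_set (the Euclidean norm) only read the values on I. *)

definition dot :: "'i set \<Rightarrow> ('i \<Rightarrow> real) \<Rightarrow> ('i \<Rightarrow> real) \<Rightarrow> real" where
  "dot I u v = (\<Sum>i\<in>I. u i * v i)"

definition frame_constants ::
    "'i set \<Rightarrow> 'w set \<Rightarrow> ('w \<Rightarrow> 'i \<Rightarrow> real) \<Rightarrow> real \<Rightarrow> real \<Rightarrow> bool" where
  "frame_constants I \<Omega> \<phi> a b \<longleftrightarrow> 0 < a \<and> a \<le> b \<and>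
     (\<forall>u. a * (L2_set u I)\<^sup>2 \<le> (\<Sum>\<omega>\<in>\<Omega>. \<bar>dot I (\<phi> \<omega>) u\<bar>\<^sup>2) \<and>
          (\<Sum>\<omega>\<in>\<Omega>. \<bar>dot I (\<phi> \<omega>) u\<bar>\<^sup>2) \<le> b * (L2_set u I)\<^sup>2)"

definition is_frame :: "'i set \<Rightarrow> 'w set \<Rightarrow> ('w \<Rightarrow> 'i \<Rightarrow> real) \<Rightarrow> bool" where
  "is_frame I \<Omega> \<phi> \<longleftrightarrow> finite \<Omega> \<and> (\<exists>a b. frame_constants I \<Omega> \<phi> a b)"

definition upper_frame_bound :: "'i set \<Rightarrow> 'w set \<Rightarrow> ('w \<Rightarrow> 'i \<Rightarrow> real) \<Rightarrow> real" where
  "upper_frame_bound I \<Omega> \<phi> = (LEAST b. \<exists>a. frame_constants I \<Omega> \<phi> a b)"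

(* The least upper constant exists whenever R^I is not the zero space. *)
lemma upper_frame_bound:
  assumes "is_frame I \<Omega> \<phi>" "finite I" "I \<noteq> {}"
  shows "\<exists>a. frame_constants I \<Omega> \<phi> a (upper_frame_bound I \<Omega> \<phi>)"
    and "frame_constants I \<Omega> \<phi> a b \<Longrightarrow> upper_frame_bound I \<Omega> \<phi> \<le> b"
proof -
  define S where "S = {b. \<exists>a. frame_constants I \<Omega> \<phi> a b}"
  define m where "m = Inf S"
  from assms(1) obtain a0 b0 where ab0: "frame_constants I \<Omega> \<phi> a0 b0"
    unfolding is_frame_def by blast
  obtain i where i: "i \<in> I" using assms(3) by blast
  define e where "e = (\<lambda>j. if j = i then 1 else 0 :: real)"
  have "(\<Sum>j\<in>I. (e j)\<^sup>2) = (\<Sum>j\<in>I. if j = i then 1 else 0)"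
    by (rule sum.cong) (auto simp: e_def)
  hence e: "(L2_set e I)\<^sup>2 = 1"
    using i assms(2) by (simp add: L2_set_def)
  have lower: "a0 \<le> b" if b: "b \<in> S" for b
  proof -
    obtain a where "frame_constants I \<Omega> \<phi> a b" using b unfolding S_def by blast
    hence "(\<Sum>\<omega>\<in>\<Omega>. \<bar>dot I (\<phi> \<omega>) e\<bar>\<^sup>2) \<le> b * (L2_set e I)\<^sup>2"
      unfolding frame_constants_def by blast
    moreover have "a0 * (L2_set e I)\<^sup>2 \<le> (\<Sum>\<omega>\<in>\<Omega>. \<bar>dot I (\<phi> \<omega>) e\<bar>\<^sup>2)"
      using ab0 unfolding frame_constants_def by blast
    ultimately show ?thesis using e by simp
  qed
  have ne: "S \<noteq> {}" using ab0 unfolding S_def by blast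
  have bdd: "bdd_below S" using lower by (rule bdd_belowI)
  have m_le: "m \<le> b" if "b \<in> S" for b
    unfolding m_def using that bdd by (rule cInf_lower)
  have a0m: "a0 \<le> m" unfolding m_def using ne lower by (rule cInf_greatest)
  have up: "(\<Sum>\<omega>\<in>\<Omega>. \<bar>dot I (\<phi> \<omega>) u\<bar>\<^sup>2) \<le> m * (L2_set u I)\<^sup>2" for u
  proof (cases "(L2_set u I)\<^sup>2 = 0")
    case True
    then show ?thesis using ab0 unfolding frame_constants_def by (metis mult_zero_right)
  next
    case False
    hence pos: "(L2_set u I)\<^sup>2 > 0" by simp
    have "(\<Sum>\<omega>\<in>\<Omega>. \<bar>dot I (\<phi> \<omega>) u\<bar>\<^sup>2) / (L2_set u I)\<^sup>2 \<le> m"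
      unfolding m_def using ne
    proof (rule cInf_greatest)
      fix b assume "b \<in> S"
      hence "(\<Sum>\<omega>\<in>\<Omega>. \<bar>dot I (\<phi> \<omega>) u\<bar>\<^sup>2) \<le> b * (L2_set u I)\<^sup>2"
        unfolding S_def frame_constants_def by blast
      thus "(\<Sum>\<omega>\<in>\<Omega>. \<bar>dot I (\<phi> \<omega>) u\<bar>\<^sup>2) / (L2_set u I)\<^sup>2 \<le> b"
        using pos by (simp add: pos_divide_le_eq)
    qed
    thus ?thesis using pos by (simp add: pos_divide_le_eq)
  qed
  have fm: "frame_constants I \<Omega> \<phi> a0 m"
    using ab0 a0m up unfolding frame_constants_def by blast
  have eq: "upper_frame_bound I \<Omega> \<phi> = m"
    unfolding upper_frame_bound_def
    by (rule Least_equality) (use fm m_le in \<open>auto simp: S_def\<close>)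
  show "\<exists>a. frame_constants I \<Omega> \<phi> a (upper_frame_bound I \<Omega> \<phi>)"
    unfolding eq using fm by blast
  show "upper_frame_bound I \<Omega> \<phi> \<le> b" if "frame_constants I \<Omega> \<phi> a b"
    unfolding eq by (rule m_le) (use that in \<open>auto simp: S_def\<close>)
qed

(* Families are indexed by n \<ge> 1; for n = 0 the space R^{I_n} is zero and has no unit vectors. *)
definition asymptotically_stable ::
    "nat \<Rightarrow> (nat \<Rightarrow> 'w set) \<Rightarrow> (nat \<Rightarrow> 'w \<Rightarrow> (nat \<Rightarrow> nat) \<Rightarrow> real) \<Rightarrow> bool" where
  "asymptotically_stable d \<Omega> \<phi> \<longleftrightarrow>
     (\<forall>n\<ge>1. is_frame (grid d n) (\<Omega> n) (\<phi> n)) \<and>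
     (\<forall>n\<ge>1. \<forall>\<omega>\<in>\<Omega> n. L2_set (\<phi> n \<omega>) (grid d n) = 1) \<and>
     (\<exists>\<rho>. 0 < \<rho> \<and> \<rho> < 1 \<and>
        (\<lambda>n. real (card {(\<omega>, \<omega>'). \<omega> \<in> \<Omega> n \<and> \<omega>' \<in> \<Omega> n \<and> \<omega> \<noteq> \<omega>' \<and>
                          \<bar>dot (grid d n) (\<phi> n \<omega>) (\<phi> n \<omega>')\<bar> \<ge> \<rho>}))
          \<in> o(\<lambda>n. real (card (\<Omega> n)) / sqrt (ln (real (card (\<Omega> n)))))) \<and>
     bdd_above ((\<lambda>n. upper_frame_bound (grid d n) (\<Omega> n) (\<phi> n)) ` {1..})"

definition standard_normal_vector :: "'a measure \<Rightarrow> 'i set \<Rightarrow> ('a \<Rightarrow> 'i \<Rightarrow> real) \<Rightarrow> bool" where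
  "standard_normal_vector M I X \<longleftrightarrow>
     prob_space.indep_vars M (\<lambda>_. borel) (\<lambda>i x. X x i) I \<and>
     (\<forall>i\<in>I. distributed M lborel (\<lambda>x. X x i) std_normal_density)"

definition gumbel_type ::
    "'a measure \<Rightarrow> (nat \<Rightarrow> 'a \<Rightarrow> real) \<Rightarrow> (nat \<Rightarrow> real) \<Rightarrow> (nat \<Rightarrow> real) \<Rightarrow> bool" where
  "gumbel_type M X a b \<longleftrightarrow>
     (\<forall>n\<ge>1. X n \<in> borel_measurable M) \<and>
     (\<forall>z. (\<lambda>n. measure M {x \<in> space M. X n x \<le> a n * z + b n}) \<longlonglongrightarrow> exp (- exp (- z)))"

definition normal_max_scale :: "nat \<Rightarrow> real" where
  "normal_max_scale m = 1 / sqrt (2 * ln (real m))"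

definition normal_max_location :: "nat \<Rightarrow> real" where
  "normal_max_location m =
     sqrt (2 * ln (real m)) - (ln (ln (real m)) + ln (4 * pi)) / (2 * sqrt (2 * ln (real m)))"

end

theory Submission
  imports Defs "HOL-Real_Asymp.Real_Asymp"
begin

text \<open>
  Write \<open>X\<^sub>\<omega> = \<langle>\<phi>\<^sub>\<omega>, \<epsilon>\<rangle>\<close>, \<open>N\<close> for the number of frame elements and \<open>p\<close> for the probability that a standard
  normal variable exceeds the threshold \<open>u\<close>, so that \<open>u\<^sup>2 \<sim> 2 log N\<close> and \<open>N p \<rightarrow> e\<^bsup>-z\<^esup>\<close>.
  Elements having correlation at least \<open>\<rho>\<close> with another one are \<open>o(N)\<close> in number and are discarded at a
  cost of \<open>o(N) p\<close>. The number \<open>W\<close> of exceedances among the others is nearly Poisson: the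
  generating function \<open>H(s) = E (1 - s)\<^sup>W\<close> satisfies \<open>H' \<approx> - \<lambda> H\<close> with \<open>\<lambda> = N p\<close>, up to the covariances of the
  event \<open>X\<^sub>i > u\<close> with a function of the remaining exceedances. These are estimated by replacing each
  \<open>X\<^sub>j\<close> by \<open>X\<^sub>j - r\<^sub>i\<^sub>j X\<^sub>i\<close>, jointly independent of \<open>X\<^sub>i\<close>; the replacement costs
  at most \<open>C \<bar>r\<^sub>i\<^sub>j\<bar> N\<^bsup>-8/5\<^esup>\<close> for small correlations and \<open>C N\<^bsup>-2/(1+\<rho>)\<^esup>\<close> otherwise, up to factors \<open>N\<^bsup>o(1)\<^esup>\<close>. The upper
  frame bound gives \<open>\<Sum>\<^sub>j r\<^sub>i\<^sub>j\<^sup>2 \<le> b\<close>, which makes the sum of all these errors vanish, since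
  \<open>N \<cdot> N\<^bsup>1/2\<^esup> \<cdot> N\<^bsup>-8/5\<^esup> \<rightarrow> 0\<close> and \<open>N \<cdot> N\<^bsup>-2/(1+\<rho>)\<^esup> \<rightarrow> 0\<close>.
\<close>

section \<open>Standard Gaussian vectors\<close>

abbreviation gauss :: "real measure" where
  "gauss \<equiv> density lborel std_normal_density"

definition std_gauss :: "'i set \<Rightarrow> ('i \<Rightarrow> real) measure" where
  "std_gauss I = PiM I (\<lambda>_. gauss)"

lemma prob_space_gauss: "prob_space gauss"
  by (rule prob_space_normal_density) simp

lemma sets_std_gauss [simp, measurable_cong]: "sets (std_gauss I) = sets (PiM I (\<lambda>_. borel))"
  unfolding std_gauss_def by (rule sets_PiM_cong) auto

lemma space_std_gauss: "space (std_gauss I) = I \<rightarrow>\<^sub>E UNIV"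
  by (simp add: std_gauss_def space_PiM)

lemma prob_space_std_gauss: "prob_space (std_gauss I)"
  unfolding std_gauss_def by (rule prob_space_PiM) (rule prob_space_gauss)

lemma measurable_dot [measurable]:
  "finite I \<Longrightarrow> (\<lambda>x. dot I v x) \<in> borel_measurable (PiM I (\<lambda>_. borel))"
  unfolding dot_def by measurable

text \<open>Completing the square in the density (\<open>d\<close>) and translation invariance of
  Lebesgue measure. This is the one-dimensional case of the formula for vectors below.\<close>

lemma nn_integral_gauss_shift:
  assumes [measurable]: "g \<in> borel_measurable borel"
  shows "(\<integral>\<^sup>+y. g (y + a) \<partial>gauss) = (\<integral>\<^sup>+y. g y * ennreal (exp (a * y - a\<^sup>2 / 2)) \<partial>gauss)"
proof -
  have d: "std_normal_density y = std_normal_density (y + a) * exp (a * (y + a) - a\<^sup>2 / 2)" for y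
    unfolding std_normal_density_def mult.assoc exp_add[symmetric]
    by (simp add: power2_eq_square field_simps)
  have "(\<integral>\<^sup>+y. g y * ennreal (exp (a * y - a\<^sup>2 / 2)) \<partial>gauss) =
     (\<integral>\<^sup>+y. ennreal (std_normal_density y * exp (a * y - a\<^sup>2 / 2)) * g y \<partial>lborel)"
    by (subst nn_integral_density) (auto simp: ennreal_mult ac_simps)
  also have "\<dots> = (\<integral>\<^sup>+y. ennreal (std_normal_density (y + a) * exp (a * (y + a) - a\<^sup>2 / 2)) * g (y + a) \<partial>lborel)"
    by (subst nn_integral_real_affine[where c = 1 and t = a]) (auto simp: add.commute)
  also have "\<dots> = (\<integral>\<^sup>+y. g (y + a) \<partial>gauss)"
    unfolding d[symmetric] by (subst nn_integral_density) auto
  finally show ?thesis by simp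
qed

lemma product_sigma_finite_gauss: "product_sigma_finite (\<lambda>_. gauss)"
  unfolding product_sigma_finite_def
  using prob_space_gauss by (auto intro: prob_space_imp_sigma_finite)

text \<open>Induction on the coordinates: the one-dimensional shift formula handles the new
  coordinate, the induction hypothesis the others, and the weights multiply because the exponent is
  additive over coordinates. Nonnegative integrals avoid all integrability conditions.\<close>

lemma cameron_martin_std_gauss:
  assumes "finite I" "f \<in> borel_measurable (PiM I (\<lambda>_. borel))"
  shows "(\<integral>\<^sup>+x. f (\<lambda>i\<in>I. x i + v i) \<partial>std_gauss I) =
         (\<integral>\<^sup>+x. f x * ennreal (exp (dot I v x - dot I v v / 2)) \<partial>std_gauss I)"
  using assms
proof (induction I arbitrary: f rule: finite_induct)
  case empty
  interpret product_sigma_finite "\<lambda>_::'a. gauss" by (rule product_sigma_finite_gauss)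
  show ?case unfolding std_gauss_def
    by (subst nn_integral_empty, simp, subst nn_integral_empty) (simp_all add: dot_def restrict_def)
next
  case (insert i I)
  interpret product_sigma_finite "\<lambda>_::'a. gauss" by (rule product_sigma_finite_gauss)
  interpret G: prob_space gauss by (rule prob_space_gauss)
  note [measurable] = insert.prems
  note [simp] = insert.hyps
  have upd [measurable]: "(\<lambda>(x, y). x(i := y)) \<in> PiM I (\<lambda>_. borel) \<Otimes>\<^sub>M borel \<rightarrow>\<^sub>M PiM (insert i I) (\<lambda>_. borel)"
    by (rule measurable_add_dim)
  have fm [measurable]: "(\<lambda>(x, y). f (x(i := y))) \<in> borel_measurable (PiM I (\<lambda>_. borel) \<Otimes>\<^sub>M borel)"
    using measurable_comp[OF upd insert.prems] by (simp add: comp_def split_beta')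
  have f2 [measurable]: "(\<lambda>y. f (x(i := y))) \<in> borel_measurable borel" if "x \<in> I \<rightarrow>\<^sub>E UNIV" for x
    using measurable_compose[OF measurable_Pair1' fm, of x] that by (simp add: space_PiM)
  have sh [measurable]: "(\<lambda>x. \<lambda>j\<in>insert i I. x j + v j) \<in> PiM (insert i I) (\<lambda>_. borel) \<rightarrow>\<^sub>M PiM (insert i I) (\<lambda>_. borel)"
    by measurable
  \<comment> \<open>The new coordinate is integrated out together with its own weight, so that the
    induction hypothesis applies to a function of the remaining ones.\<close>
  define g where "g w = (\<integral>\<^sup>+y. f (w(i := y)) * ennreal (exp (v i * y - (v i)\<^sup>2 / 2)) \<partial>gauss)" for w
  have g [measurable]: "g \<in> borel_measurable (PiM I (\<lambda>_. borel))"
    unfolding g_def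
  proof (rule sigma_finite_measure.borel_measurable_nn_integral)
    show "sigma_finite_measure gauss" ..
    show "(\<lambda>(w, y). f (w(i := y)) * ennreal (exp (v i * y - (v i)\<^sup>2 / 2))) \<in> borel_measurable (Pi\<^sub>M I (\<lambda>_. borel) \<Otimes>\<^sub>M gauss)"
      using fm by (simp add: split_beta') 
  qed
  have dotupd: "dot (insert i I) v (x(i := y)) = v i * y + dot I v x" for x y
    by (simp add: dot_def) (rule sum.cong, auto)
  have "(\<integral>\<^sup>+x. f (\<lambda>j\<in>insert i I. x j + v j) \<partial>std_gauss (insert i I)) =
      (\<integral>\<^sup>+x. \<integral>\<^sup>+y. f (\<lambda>j\<in>insert i I. (x(i := y)) j + v j) \<partial>gauss \<partial>std_gauss I)"
    unfolding std_gauss_def using measurable_compose[OF sh insert.prems]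
    by (subst product_nn_integral_insert) (auto cong: measurable_cong_sets sets_PiM_cong)
  also have "\<dots> = (\<integral>\<^sup>+x. g (\<lambda>j\<in>I. x j + v j) \<partial>std_gauss I)"
  proof (rule nn_integral_cong)
    fix x assume "x \<in> space (std_gauss I)"
    let ?w = "\<lambda>j\<in>I. x j + v j"
    have "(\<lambda>j\<in>insert i I. (x(i := y)) j + v j) = ?w(i := y + v i)" for y
      by (auto simp: fun_eq_iff restrict_def)
    then show "(\<integral>\<^sup>+y. f (\<lambda>j\<in>insert i I. (x(i := y)) j + v j) \<partial>gauss) = g ?w"
      unfolding g_def using nn_integral_gauss_shift[OF f2, of ?w "v i"] by simp
  qed
  also have "\<dots> = (\<integral>\<^sup>+x. g x * ennreal (exp (dot I v x - dot I v v / 2)) \<partial>std_gauss I)"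
    by (rule insert.IH) (rule g)
  also have "\<dots> = (\<integral>\<^sup>+x. \<integral>\<^sup>+y. f (x(i := y)) * ennreal (exp (dot (insert i I) v (x(i := y)) - dot (insert i I) v v / 2)) \<partial>gauss \<partial>std_gauss I)"
  proof (rule nn_integral_cong)
    fix x assume x: "x \<in> space (std_gauss I)"
    then have [measurable]: "(\<lambda>y. f (x(i := y))) \<in> borel_measurable borel"
      by (intro f2) (simp add: space_std_gauss)
    have "g x * ennreal (exp (dot I v x - dot I v v / 2)) =
       (\<integral>\<^sup>+y. f (x(i := y)) * ennreal (exp (v i * y - (v i)\<^sup>2 / 2)) * ennreal (exp (dot I v x - dot I v v / 2)) \<partial>gauss)"
      unfolding g_def by (subst nn_integral_multc) auto
    also have "\<dots> = (\<integral>\<^sup>+y. f (x(i := y)) * ennreal (exp (dot (insert i I) v (x(i := y)) - dot (insert i I) v v / 2)) \<partial>gauss)"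
      unfolding dotupd
      by (simp add: mult.assoc ennreal_mult[symmetric] exp_add[symmetric])
        (simp add: dot_def power2_eq_square algebra_simps add_divide_distrib)
    finally show "g x * ennreal (exp (dot I v x - dot I v v / 2)) = \<dots>" .
  qed
  also have "\<dots> = (\<integral>\<^sup>+x. f x * ennreal (exp (dot (insert i I) v x - dot (insert i I) v v / 2)) \<partial>std_gauss (insert i I))"
    unfolding std_gauss_def using insert.prems
    by (subst product_nn_integral_insert) (auto cong: measurable_cong_sets sets_PiM_cong)
  finally show ?case .
qed

text \<open>For a unit vector \<open>v\<close> this is the orthogonal projection onto the complement
  of \<open>v\<close>. The restriction to \<open>I\<close> keeps the result in the extensional
  product space.\<close>

definition proj_perp :: "'i set \<Rightarrow> ('i \<Rightarrow> real) \<Rightarrow> ('i \<Rightarrow> real) \<Rightarrow> 'i \<Rightarrow> real" where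
  "proj_perp I v x = (\<lambda>i\<in>I. x i - dot I v x * v i)"

lemma measurable_proj_perp [measurable]:
  "finite I \<Longrightarrow> proj_perp I v \<in> PiM I (\<lambda>_. borel) \<rightarrow>\<^sub>M PiM I (\<lambda>_. borel)"
  unfolding proj_perp_def by measurable

text \<open>In the Cameron--Martin formula for shifts along \<open>c v\<close> the projection does not change;
  integrating it over \<open>c\<close> against Lebesgue measure replaces \<open>dot I v x\<close> by a free variable.\<close>

lemma nn_integral_std_gauss_split:
  assumes "finite I" and F: "(\<lambda>(a, y). F a y) \<in> borel_measurable (borel \<Otimes>\<^sub>M PiM I (\<lambda>_. borel))"
    and v: "dot I v v = 1"
  shows "(\<integral>\<^sup>+x. F (dot I v x) (proj_perp I v x) \<partial>std_gauss I) =
         (\<integral>\<^sup>+x. \<integral>\<^sup>+a. F a (proj_perp I v x) \<partial>gauss \<partial>std_gauss I)"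
proof -
  note [simp] = \<open>finite I\<close>
  note [measurable] = F
  interpret G: prob_space gauss by (rule prob_space_gauss)
  interpret S: prob_space "std_gauss I" by (rule prob_space_std_gauss)
  interpret P: pair_sigma_finite "std_gauss I" "lborel :: real measure" ..
  \<comment> \<open>With the normal density absorbed into \<open>H\<close>, the inner integral is
    over Lebesgue measure and can be translated.\<close>
  define H where "H a y = F a y * ennreal (std_normal_density a)" for a y
  have H [measurable]: "(\<lambda>(a, y). H a y) \<in> borel_measurable (borel \<Otimes>\<^sub>M PiM I (\<lambda>_. borel))"
    unfolding H_def using F by (simp add: split_beta')
  have dv: "dot I v (\<lambda>i\<in>I. x i + c * v i) = dot I v x + c" for x c
  proof -
    have "dot I v (\<lambda>i\<in>I. x i + c * v i) = dot I v x + c * dot I v v"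
      by (simp add: dot_def sum.distrib sum_distrib_left algebra_simps cong: sum.cong)
    then show ?thesis by (simp add: v)
  qed
  have pv: "proj_perp I v (\<lambda>i\<in>I. x i + c * v i) = proj_perp I v x" for x c
    unfolding proj_perp_def dv by (auto simp: algebra_simps)
  have Fm [measurable]: "(\<lambda>a. F a y) \<in> borel_measurable borel" if "y \<in> I \<rightarrow>\<^sub>E UNIV" for y
    using measurable_compose[OF measurable_Pair2' F, of y] that by (simp add: space_PiM)
  have Hm [measurable]: "(\<lambda>a. H a y) \<in> borel_measurable borel" if "y \<in> I \<rightarrow>\<^sub>E UNIV" for y
    unfolding H_def using Fm[OF that] by measurable
  have pE: "proj_perp I v x \<in> I \<rightarrow>\<^sub>E UNIV" for x by (simp add: proj_perp_def)
  have Hc [measurable]: "(\<lambda>x. H (dot I v x) (proj_perp I v x)) \<in> borel_measurable (PiM I (\<lambda>_. borel))"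
  proof -
    have "(\<lambda>x. (dot I v x, proj_perp I v x)) \<in> PiM I (\<lambda>_. borel) \<rightarrow>\<^sub>M borel \<Otimes>\<^sub>M PiM I (\<lambda>_. borel)"
      by measurable
    from measurable_compose[OF this H] show ?thesis by simp
  qed
  have Hc2 [measurable]: "(\<lambda>(x, c). H (dot I v x + c) (proj_perp I v x)) \<in> borel_measurable (PiM I (\<lambda>_. borel) \<Otimes>\<^sub>M lborel)"
  proof -
    have "(\<lambda>z. (dot I v (fst z) + snd z, proj_perp I v (fst z))) \<in> PiM I (\<lambda>_. borel) \<Otimes>\<^sub>M (lborel :: real measure) \<rightarrow>\<^sub>M borel \<Otimes>\<^sub>M PiM I (\<lambda>_. borel)"
      by measurable
    from measurable_compose[OF this H] show ?thesis by (simp add: split_beta')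
  qed
  have Hc3 [measurable]: "(\<lambda>(x, c). H (dot I v x) (proj_perp I v x) * ennreal (exp (c * dot I v x - c\<^sup>2 / 2))) \<in> borel_measurable (PiM I (\<lambda>_. borel) \<Otimes>\<^sub>M lborel)"
    using Hc by (simp add: split_beta')
  have cm: "(\<integral>\<^sup>+x. H (dot I v x + c) (proj_perp I v x) \<partial>std_gauss I) =
     (\<integral>\<^sup>+x. H (dot I v x) (proj_perp I v x) * ennreal (exp (c * dot I v x - c\<^sup>2 / 2)) \<partial>std_gauss I)" for c
  proof -
    have "dot I (\<lambda>i. c * v i) x = c * dot I v x" for x
      by (simp add: dot_def sum_distrib_left mult.assoc)
    moreover have "dot I (\<lambda>i. c * v i) (\<lambda>i. c * v i) = c\<^sup>2 * dot I v v"
      by (simp add: dot_def sum_distrib_left power2_eq_square ac_simps)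
    ultimately show ?thesis
      using cameron_martin_std_gauss[OF \<open>finite I\<close> Hc, of "\<lambda>i. c * v i"]
      by (simp add: dv pv v)
  qed
  \<comment> \<open>As a function of \<open>c\<close>, the Cameron-Martin weight times the standard
    normal density at \<open>p\<close> is the normal density with mean \<open>p\<close> and variance
    1.\<close>
  have gi: "(\<integral>\<^sup>+c. ennreal (exp (c * p - c\<^sup>2 / 2)) \<partial>lborel) * ennreal (std_normal_density p) = 1" for p
  proof -
    have e: "exp (c * p - c\<^sup>2 / 2) * std_normal_density p = normal_density p 1 c" for c
      unfolding normal_density_def 
      by (simp add: power2_eq_square algebra_simps exp_add[symmetric] add_divide_distrib diff_divide_distrib flip: exp_diff exp_minus)
    have "(\<integral>\<^sup>+c. ennreal (exp (c * p - c\<^sup>2 / 2)) \<partial>lborel) * ennreal (std_normal_density p) =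
      (\<integral>\<^sup>+c. ennreal (normal_density p 1 c) \<partial>lborel)"
      by (subst nn_integral_multc[symmetric]) (auto simp: ennreal_mult[symmetric] e)
    also have "\<dots> = 1"
      using nn_integral_eq_integral[of lborel "normal_density p 1"] by simp
    finally show ?thesis .
  qed
  have "(\<integral>\<^sup>+x. \<integral>\<^sup>+a. F a (proj_perp I v x) \<partial>gauss \<partial>std_gauss I) =
      (\<integral>\<^sup>+x. \<integral>\<^sup>+c. H c (proj_perp I v x) \<partial>lborel \<partial>std_gauss I)"
    unfolding H_def by (intro nn_integral_cong, subst nn_integral_density) (auto simp: Fm pE mult.commute)
  \<comment> \<open>For fixed \<open>x\<close> the Lebesgue variable is translated by
    \<open>dot I v x\<close>. After Fubini this becomes a shift of \<open>x\<close> along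
    \<open>c * v\<close>, to which \<open>cm\<close> applies.\<close>
  also have "\<dots> = (\<integral>\<^sup>+x. \<integral>\<^sup>+c. H (dot I v x + c) (proj_perp I v x) \<partial>lborel \<partial>std_gauss I)"
    using nn_integral_real_affine[OF Hm[OF pE], of 1] by simp
  also have "\<dots> = (\<integral>\<^sup>+c. \<integral>\<^sup>+x. H (dot I v x + c) (proj_perp I v x) \<partial>std_gauss I \<partial>lborel)"
    by (rule P.Fubini'[symmetric]) (use Hc2 in \<open>simp cong: measurable_cong_sets sets_pair_measure_cong\<close>)
  also have "\<dots> = (\<integral>\<^sup>+c. \<integral>\<^sup>+x. H (dot I v x) (proj_perp I v x) * ennreal (exp (c * dot I v x - c\<^sup>2 / 2)) \<partial>std_gauss I \<partial>lborel)"
    by (simp only: cm)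
  also have "\<dots> = (\<integral>\<^sup>+x. \<integral>\<^sup>+c. H (dot I v x) (proj_perp I v x) * ennreal (exp (c * dot I v x - c\<^sup>2 / 2)) \<partial>lborel \<partial>std_gauss I)"
    by (rule P.Fubini') (use Hc3 in \<open>simp cong: measurable_cong_sets sets_pair_measure_cong\<close>)
  also have "\<dots> = (\<integral>\<^sup>+x. F (dot I v x) (proj_perp I v x) \<partial>std_gauss I)"
  proof (rule nn_integral_cong)
    fix x
    let ?p = "dot I v x"
    have "(\<integral>\<^sup>+c. H ?p (proj_perp I v x) * ennreal (exp (c * ?p - c\<^sup>2 / 2)) \<partial>lborel) =
      F ?p (proj_perp I v x) * ((\<integral>\<^sup>+c. ennreal (exp (c * ?p - c\<^sup>2 / 2)) \<partial>lborel) * ennreal (std_normal_density ?p))"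
      by (subst nn_integral_cmult) (auto simp: H_def ac_simps)
    then show "(\<integral>\<^sup>+c. H ?p (proj_perp I v x) * ennreal (exp (c * ?p - c\<^sup>2 / 2)) \<partial>lborel) = F ?p (proj_perp I v x)"
      by (simp add: gi)
  qed
  finally show ?thesis ..
qed

section \<open>Bilinearity, and the laws of linear functionals of a Gaussian vector\<close>

lemma dot_commute: "dot I v w = dot I w v"
  by (simp add: dot_def mult.commute)

lemma dot_add_left: "dot I (\<lambda>i. a i + b i) w = dot I a w + dot I b w"
  by (simp add: dot_def sum.distrib distrib_right)

lemma dot_diff_left: "dot I (\<lambda>i. a i - b i) w = dot I a w - dot I b w"
  by (simp add: dot_def sum_subtractf left_diff_distrib)

lemma dot_scale_left: "dot I (\<lambda>i. c * a i) w = c * dot I a w"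
  by (simp add: dot_def sum_distrib_left mult.assoc)

lemma dot_add_right: "dot I w (\<lambda>i. a i + b i) = dot I w a + dot I w b"
  by (metis dot_add_left dot_commute)

lemma dot_diff_right: "dot I w (\<lambda>i. a i - b i) = dot I w a - dot I w b"
  by (metis dot_diff_left dot_commute)

lemma dot_scale_right: "dot I w (\<lambda>i. c * a i) = c * dot I w a"
  by (metis dot_scale_left dot_commute)

lemmas dot_simps = dot_add_left dot_diff_left dot_scale_left dot_add_right dot_diff_right dot_scale_right

lemma dot_proj_perp: "dot I w (proj_perp I v x) = dot I w x - dot I v x * dot I w v"
proof -
  have "dot I w (proj_perp I v x) = dot I w (\<lambda>i. x i - dot I v x * v i)"
    unfolding proj_perp_def dot_def by (rule sum.cong) auto
  then show ?thesis by (simp add: dot_simps)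
qed

lemma nn_integral_dot_unit:
  assumes "finite I" "dot I v v = 1" and [measurable]: "g \<in> borel_measurable borel"
  shows "(\<integral>\<^sup>+x. g (dot I v x) \<partial>std_gauss I) = (\<integral>\<^sup>+a. g a \<partial>gauss)"
proof -
  interpret S: prob_space "std_gauss I" by (rule prob_space_std_gauss)
  show ?thesis
    using nn_integral_std_gauss_split[of I "\<lambda>a y. g a" v] assms by (simp add: S.emeasure_space_1)
qed

text \<open>Since \<open>w\<close> is orthogonal to \<open>v\<close>, \<open>dot I w\<close> takes
  the same value at \<open>x\<close> and at its projection. Hence splitting off \<open>v\<close>
  frees the first argument only, and the law of \<open>dot I w x\<close> finishes.\<close>

lemma nn_integral_dot_orthonormal:
  assumes "finite I" "dot I v v = 1" "dot I w w = 1" "dot I v w = 0"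
    and F [measurable]: "(\<lambda>(a, b). F a b) \<in> borel_measurable (borel \<Otimes>\<^sub>M borel)"
  shows "(\<integral>\<^sup>+x. F (dot I v x) (dot I w x) \<partial>std_gauss I) = (\<integral>\<^sup>+b. \<integral>\<^sup>+a. F a b \<partial>gauss \<partial>gauss)"
proof -
  note [simp] = \<open>finite I\<close>
  interpret G: prob_space gauss by (rule prob_space_gauss)
  have w: "dot I w (proj_perp I v x) = dot I w x" for x
    using assms by (simp add: dot_proj_perp dot_commute[of I w v])
  have "(\<lambda>z. (fst z, dot I w (snd z))) \<in> borel \<Otimes>\<^sub>M PiM I (\<lambda>_. borel) \<rightarrow>\<^sub>M (borel :: real measure) \<Otimes>\<^sub>M (borel :: real measure)"
    by measurable
  from measurable_compose[OF this F]
  have "(\<integral>\<^sup>+x. F (dot I v x) (dot I w x) \<partial>std_gauss I) = (\<integral>\<^sup>+x. \<integral>\<^sup>+a. F a (dot I w x) \<partial>gauss \<partial>std_gauss I)"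
    using nn_integral_std_gauss_split[of I "\<lambda>a y. F a (dot I w y)" v] assms
    by (simp add: w split_beta')
  also have "\<dots> = (\<integral>\<^sup>+b. \<integral>\<^sup>+a. F a b \<partial>gauss \<partial>gauss)"
  proof (rule nn_integral_dot_unit)
    have "sigma_finite_measure gauss" ..
    moreover have "(\<lambda>(b, a). F a b) \<in> borel_measurable (borel \<Otimes>\<^sub>M gauss)"
      using measurable_compose[OF measurable_pair_swap' F] by (simp add: split_beta' cong: measurable_cong_sets sets_pair_measure_cong)
    ultimately show "(\<lambda>b. \<integral>\<^sup>+a. F a b \<partial>gauss) \<in> borel_measurable borel"
      by (rule sigma_finite_measure.borel_measurable_nn_integral)
  qed (use assms in auto)
  finally show ?thesis .
qed

section \<open>Exponential moments and tail bounds\<close>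

text \<open>The Cameron-Martin formula for the constant function 1 says that the weight has total
  mass 1.\<close>

lemma nn_integral_exp_dot:
  assumes "finite I"
  shows "(\<integral>\<^sup>+x. ennreal (exp (dot I v x)) \<partial>std_gauss I) = ennreal (exp (dot I v v / 2))"
proof -
  interpret S: prob_space "std_gauss I" by (rule prob_space_std_gauss)
  note [simp] = assms
  have "1 = (\<integral>\<^sup>+x. ennreal (exp (dot I v x - dot I v v / 2)) \<partial>std_gauss I)"
    using cameron_martin_std_gauss[OF assms, of "\<lambda>_. 1" v] by (simp add: S.emeasure_space_1)
  also have "\<dots> = (\<integral>\<^sup>+x. ennreal (exp (dot I v x)) * ennreal (exp (- dot I v v / 2)) \<partial>std_gauss I)"
    by (simp add: ennreal_mult[symmetric] exp_add[symmetric])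
  also have "\<dots> = (\<integral>\<^sup>+x. ennreal (exp (dot I v x)) \<partial>std_gauss I) * ennreal (exp (- dot I v v / 2))"
    by (rule nn_integral_multc) measurable
  finally have "1 * ennreal (exp (dot I v v / 2)) =
     (\<integral>\<^sup>+x. ennreal (exp (dot I v x)) \<partial>std_gauss I) * (ennreal (exp (- dot I v v / 2)) * ennreal (exp (dot I v v / 2)))"
    by (simp flip: mult.assoc)
  then show ?thesis by (simp add: ennreal_mult[symmetric] exp_add[symmetric])
qed

text \<open>Markov's inequality for \<open>exp (dot I v x)\<close>. The event is arbitrary, so that
  single and joint exceedances are both covered by a suitable choice of \<open>v\<close>.\<close>

lemma std_gauss_chernoff:
  assumes "finite I" and A: "A \<in> sets (PiM I (\<lambda>_. borel))" and le: "\<And>x. x \<in> A \<Longrightarrow> k \<le> dot I v x"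
  shows "measure (std_gauss I) A \<le> exp (dot I v v / 2 - k)"
proof -
  interpret S: prob_space "std_gauss I" by (rule prob_space_std_gauss)
  note [simp] = \<open>finite I\<close>
  have "ennreal (measure (std_gauss I) A) = (\<integral>\<^sup>+x. indicator A x \<partial>std_gauss I)"
    using A by (simp add: S.emeasure_eq_measure)
  also have "\<dots> \<le> (\<integral>\<^sup>+x. ennreal (exp (dot I v x)) * ennreal (exp (- k)) \<partial>std_gauss I)"
    by (rule nn_integral_mono)
      (use le in \<open>auto simp: indicator_def ennreal_mult[symmetric] exp_add[symmetric] simp flip: ennreal_1\<close>)
  also have "\<dots> = (\<integral>\<^sup>+x. ennreal (exp (dot I v x)) \<partial>std_gauss I) * ennreal (exp (- k))"
    by (rule nn_integral_multc) measurable
  also have "\<dots> = ennreal (exp (dot I v v / 2 - k))"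
    by (simp add: nn_integral_exp_dot ennreal_mult[symmetric] exp_add[symmetric])
  finally show ?thesis by simp
qed

lemma std_gauss_tail:
  assumes "finite I" "dot I v v \<le> 1" "0 \<le> u"
  shows "measure (std_gauss I) {x \<in> space (std_gauss I). u < dot I v x} \<le> exp (- (u\<^sup>2 / 2))"
proof -
  note [simp] = \<open>finite I\<close>
  have m: "{x \<in> space (std_gauss I). u < dot I v x} \<in> sets (PiM I (\<lambda>_. borel))"
    unfolding sets_std_gauss[symmetric] by measurable
  have "measure (std_gauss I) {x \<in> space (std_gauss I). u < dot I v x} \<le>
     exp (dot I (\<lambda>i. u * v i) (\<lambda>i. u * v i) / 2 - u * u)"
    by (rule std_gauss_chernoff[OF assms(1) m]) (use assms in \<open>auto simp: dot_simps intro!: mult_left_mono\<close>)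
  also have "\<dots> \<le> exp (- (u\<^sup>2 / 2))"
    using mult_left_mono[OF assms(2), of "u\<^sup>2"] by (simp add: dot_simps power2_eq_square mult.assoc)
  finally show ?thesis .
qed

text \<open>On the joint event the functional of \<open>v + w\<close> exceeds \<open>2 * u\<close>,
  while its variance is at most \<open>2 + 2 * \<rho>\<close>; the Chernoff bound is applied to a
  multiple of \<open>v + w\<close>.\<close>

lemma std_gauss_joint_tail:
  assumes "finite I" "dot I v v = 1" "dot I w w = 1" "dot I v w \<le> \<rho>" "0 \<le> \<rho>" "0 \<le> u"
  shows "measure (std_gauss I) {x \<in> space (std_gauss I). u < dot I v x \<and> u < dot I w x} \<le> exp (- (u\<^sup>2 / (1 + \<rho>)))"
proof -
  note [simp] = \<open>finite I\<close>
  \<comment> \<open>The minimiser of \<open>t^2 * (1 + \<rho>) - 2 * t * u\<close>, the exponent of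
    the Chernoff bound.\<close>
  define t where "t = u / (1 + \<rho>)"
  have t0: "0 \<le> t" and tu: "t * (1 + \<rho>) = u" using assms by (auto simp: t_def)
  have m: "{x \<in> space (std_gauss I). u < dot I v x \<and> u < dot I w x} \<in> sets (PiM I (\<lambda>_. borel))"
    unfolding sets_std_gauss[symmetric] by measurable
  let ?w = "\<lambda>i. t * (v i + w i)"
  have "measure (std_gauss I) {x \<in> space (std_gauss I). u < dot I v x \<and> u < dot I w x} \<le>
     exp (dot I ?w ?w / 2 - t * (2 * u))"
    by (rule std_gauss_chernoff[OF assms(1) m]) (use t0 in \<open>auto simp: dot_simps intro!: mult_left_mono\<close>)
  also have "dot I ?w ?w = t * (t * (2 + 2 * dot I v w))"
    using assms(2,3) by (simp add: dot_simps dot_commute[of I w v] algebra_simps)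
  also have "t * (t * (2 + 2 * dot I v w)) \<le> t * (t * (2 + 2 * \<rho>))"
    using t0 assms(4) by (intro mult_left_mono) auto
  also have "t * (t * (2 + 2 * \<rho>)) = 2 * (t * u)" by (simp add: tu[symmetric] algebra_simps)
  also have "2 * (t * u) / 2 - t * (2 * u) = - (t * u)" by simp
  also have "t * u = u\<^sup>2 / (1 + \<rho>)" by (simp add: t_def power2_eq_square)
  finally show ?thesis by simp
qed

lemma nn_integral_exp_abs_gauss:
  "(\<integral>\<^sup>+a. ennreal (exp (k * \<bar>a\<bar>)) \<partial>gauss) \<le> ennreal (2 * exp (k\<^sup>2 / 2))"
proof -
  interpret G: prob_space gauss by (rule prob_space_gauss)
  \<comment> \<open>The moment generating function is read off from a Gaussian vector with a single
    coordinate.\<close>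
  have e: "(\<integral>\<^sup>+a. ennreal (exp (c * a)) \<partial>gauss) = ennreal (exp (c\<^sup>2 / 2))" for c :: real
  proof -
    have "(\<integral>\<^sup>+a. ennreal (exp (c * a)) \<partial>gauss) = (\<integral>\<^sup>+x. ennreal (exp (dot {()} (\<lambda>_. c) x)) \<partial>std_gauss {()})"
      using nn_integral_dot_unit[of "{()}" "\<lambda>_. 1" "\<lambda>a. ennreal (exp (c * a))"]
      by (simp add: dot_def)
    then show ?thesis by (simp add: nn_integral_exp_dot) (simp add: dot_def power2_eq_square)
  qed
  have "(\<integral>\<^sup>+a. ennreal (exp (k * \<bar>a\<bar>)) \<partial>gauss) \<le> (\<integral>\<^sup>+a. ennreal (exp (k * a)) + ennreal (exp (- k * a)) \<partial>gauss)"
    by (rule nn_integral_mono) (auto simp: abs_if ennreal_plus[symmetric] simp del: ennreal_plus intro!: ennreal_leI)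
  also have "\<dots> = (\<integral>\<^sup>+a. ennreal (exp (k * a)) \<partial>gauss) + (\<integral>\<^sup>+a. ennreal (exp (- k * a)) \<partial>gauss)"
    by (rule nn_integral_add) auto
  also have "\<dots> = ennreal (2 * exp (k\<^sup>2 / 2))"
    using e[of k] e[of "-k"] by (simp add: ennreal_plus[symmetric] del: ennreal_plus)
  finally show ?thesis .
qed

text \<open>The event consists of \<open>b\<close> in an interval of length \<open>\<bar>r a\<bar> / s\<close> with an end point \<open>u / s\<close>.\<close>

lemma gauss_between:
  assumes u: "0 \<le> u" and r: "\<bar>r\<bar> \<le> 1/8" and s: "1/2 \<le> s" "s \<le> 1"
  shows "(\<integral>\<^sup>+b. of_bool ((u < s * b + r * a) \<noteq> (u < s * b)) \<partial>gauss) \<le>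
     ennreal (\<bar>r\<bar> * \<bar>a\<bar> * exp (u * \<bar>a\<bar> / 8 - u\<^sup>2 / 2))"
proof -
  define lo hi where "lo = min u (u - r * a) / s" and "hi = max u (u - r * a) / s"
  \<comment> \<open>A bound for the density on the interval: there \<open>b^2\<close> is at least
    \<open>u^2 - u * |a| / 4\<close> because \<open>|r| \<le> 1/8\<close>, and
    \<open>1 / sqrt (2 * pi) \<le> 1/2\<close>.\<close>
  define K where "K = exp (u * \<bar>a\<bar> / 8 - u\<^sup>2 / 2) / 2"
  have K0: "0 \<le> K" by (simp add: K_def)
  have lohi: "lo \<le> hi" unfolding lo_def hi_def using s by (intro divide_right_mono) auto
  have pt: "ennreal (std_normal_density b) * of_bool ((u < s * b + r * a) \<noteq> (u < s * b)) \<le> ennreal K * indicator {lo..hi} b" for b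
  proof (cases "(u < s * b + r * a) \<noteq> (u < s * b)")
    case True
    have v: "\<bar>r * a\<bar> \<le> \<bar>a\<bar> / 8" using mult_right_mono[OF r, of "\<bar>a\<bar>"] by (simp add: abs_mult)
    have in_K: "b \<in> {lo..hi}" using True s by (auto simp: lo_def hi_def field_simps min_def max_def)
    have sb: "s * b \<ge> u - \<bar>r * a\<bar>" using True by auto
    have "u\<^sup>2 - 2 * u * \<bar>r * a\<bar> \<le> (s * b)\<^sup>2"
    proof (cases "\<bar>r * a\<bar> \<le> u")
      case True
      then have "(u - \<bar>r * a\<bar>)\<^sup>2 \<le> (s * b)\<^sup>2" using sb by (intro power_mono) auto
      moreover have "u\<^sup>2 - 2 * u * \<bar>r * a\<bar> \<le> (u - \<bar>r * a\<bar>)\<^sup>2"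
        by (simp add: power2_diff)
      ultimately show ?thesis by linarith
    next
      \<comment> \<open>Here the left-hand side is at most 0.\<close>
      case False
      then have "u * u \<le> u * \<bar>r * a\<bar>" using u by (intro mult_left_mono) auto
      moreover have "0 \<le> u * u" by simp
      moreover have "0 \<le> (s * b)\<^sup>2" by simp
      ultimately show ?thesis unfolding power2_eq_square[of u] mult.assoc by linarith
    qed
    also have "(s * b)\<^sup>2 \<le> b\<^sup>2"
      using s by (simp add: power_mult_distrib mult_left_le_one_le power_le_one)
    finally have "u\<^sup>2 - 2 * u * \<bar>r * a\<bar> \<le> b\<^sup>2" .
    moreover have "u * \<bar>r * a\<bar> \<le> u * (\<bar>a\<bar> / 8)" using u v by (intro mult_left_mono)
    ultimately have "- b\<^sup>2 / 2 \<le> u * \<bar>a\<bar> / 8 - u\<^sup>2 / 2" by (simp add: algebra_simps)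
    moreover have "1 / sqrt (2 * pi) \<le> 1 / 2"
    proof -
      have "sqrt (2 * pi) \<ge> sqrt (2\<^sup>2)" using pi_gt3 by (subst real_sqrt_le_iff) simp
      then show ?thesis by (simp add: field_simps)
    qed
    ultimately have "std_normal_density b \<le> (1/2) * exp (u * \<bar>a\<bar> / 8 - u\<^sup>2 / 2)"
      unfolding std_normal_density_def by (intro mult_mono) auto
    then show ?thesis using True in_K by (simp add: K_def ennreal_leI)
  qed simp
  have "(\<integral>\<^sup>+b. of_bool ((u < s * b + r * a) \<noteq> (u < s * b)) \<partial>gauss) =
     (\<integral>\<^sup>+b. ennreal (std_normal_density b) * of_bool ((u < s * b + r * a) \<noteq> (u < s * b)) \<partial>lborel)"
    by (subst nn_integral_density) auto
  also have "\<dots> \<le> (\<integral>\<^sup>+b. ennreal K * indicator {lo..hi} b \<partial>lborel)"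
    by (rule nn_integral_mono) (rule pt)
  also have "\<dots> = ennreal K * ennreal (hi - lo)"
    using lohi by (simp add: nn_integral_cmult)
  also have "\<dots> = ennreal (K * (hi - lo))" using K0 lohi by (simp add: ennreal_mult)
  also have "\<dots> \<le> ennreal (\<bar>r\<bar> * \<bar>a\<bar> * exp (u * \<bar>a\<bar> / 8 - u\<^sup>2 / 2))"
  proof (rule ennreal_leI)
    have "hi - lo = \<bar>r * a\<bar> / s"
      unfolding hi_def lo_def by (auto simp: max_def min_def diff_divide_distrib[symmetric])
    \<comment> \<open>The factor 2 obtained from \<open>s \<ge> 1/2\<close> cancels the factor 1/2
      in \<open>K\<close>.\<close>
    also have "\<dots> \<le> \<bar>r * a\<bar> / (1/2)" using s by (intro divide_left_mono) auto
    finally have "K * (hi - lo) \<le> K * (2 * \<bar>r * a\<bar>)" using K0 by (intro mult_left_mono) auto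
    then show "K * (hi - lo) \<le> \<bar>r\<bar> * \<bar>a\<bar> * exp (u * \<bar>a\<bar> / 8 - u\<^sup>2 / 2)"
      by (simp add: K_def abs_mult ac_simps)
  qed
  finally show ?thesis .
qed

section \<open>Poisson approximation of exceedances\<close>

text \<open>The proof compares \<open>H s = E (1 - s)\<^sup>W\<close>, where \<open>W\<close> counts the events that occur, with the solution
  \<open>exp (- \<lambda> s)\<close> of \<open>H' = - \<lambda> H\<close>; at \<open>s = 1\<close> it is the probability that no event occurs.\<close>

lemma (in prob_space) poisson_approximation:
  fixes A :: "'i \<Rightarrow> 'a set" and c :: "'i \<Rightarrow> real"
  assumes J: "finite J" and A [measurable]: "\<And>j. j \<in> J \<Longrightarrow> A j \<in> events"
    and cov: "\<And>i s. i \<in> J \<Longrightarrow> 0 \<le> s \<Longrightarrow> s \<le> 1 \<Longrightarrow>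
      \<bar>expectation (\<lambda>x. indicator (A i) x * (\<Prod>j\<in>J-{i}. 1 - s * indicator (A j) x)) -
       prob (A i) * expectation (\<lambda>x. \<Prod>j\<in>J-{i}. 1 - s * indicator (A j) x)\<bar> \<le> c i"
  shows "\<bar>prob {x \<in> space M. \<forall>j\<in>J. x \<notin> A j} - exp (- (\<Sum>j\<in>J. prob (A j)))\<bar> \<le> (\<Sum>i\<in>J. (prob (A i))\<^sup>2 + c i)"
proof -
  define W where "W x = card {j \<in> J. x \<in> A j}" for x
  define q where "q k = prob {x \<in> space M. W x = k}" for k
  define n where "n = card J"
  define p where "p j = prob (A j)" for j
  define lam where "lam = (\<Sum>j\<in>J. p j)"
  define \<Delta> where "\<Delta> = (\<Sum>i\<in>J. (p i)\<^sup>2 + c i)"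
  have prodW: "(\<Prod>j\<in>J. 1 - s * indicator (A j) x) = (1 - s) ^ W x" for s :: real and x
  proof -
    have "(\<Prod>j\<in>J. 1 - s * indicator (A j) x) = (\<Prod>j\<in>J. if x \<in> A j then 1 - s else 1)"
      by (intro prod.cong) (auto simp: indicator_def)
    also have "\<dots> = (1 - s) ^ card {j \<in> J. x \<in> A j}"
      using J by (simp add: prod.If_cases Int_def)
    finally show ?thesis by (simp add: W_def)
  qed
  have Wn: "W x \<le> n" for x unfolding W_def n_def by (rule card_mono) (use J in auto)
  have Wsum: "real (W x) = (\<Sum>j\<in>J. indicator (A j) x)" for x
    unfolding W_def using J by (simp add: indicator_def sum.If_cases Int_def)
  have mW [measurable]: "{x \<in> space M. W x = k} \<in> events" for k
  proof -
    have "{x \<in> space M. W x = k} = {x \<in> space M. (\<Sum>j\<in>J. indicator (A j) x) = real k}"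
      using Wsum by (metis of_nat_eq_iff)
    also have "\<dots> \<in> events" by measurable
    finally show ?thesis .
  qed
  \<comment> \<open>Writing expectations as finite sums over the values of \<open>W\<close> makes
    \<open>H\<close> a polynomial in \<open>s\<close>, which can be differentiated term by
    term.\<close>
  have EW: "expectation (\<lambda>x. g (W x)) = (\<Sum>k\<le>n. g k * q k)" for g :: "nat \<Rightarrow> real"
  proof -
    have "expectation (\<lambda>x. g (W x)) = expectation (\<lambda>x. \<Sum>k\<le>n. g k * indicator {x \<in> space M. W x = k} x)"
    proof (rule Bochner_Integration.integral_cong[OF refl])
      fix x assume "x \<in> space M"
      then have "(\<Sum>k\<le>n. g k * indicator {x \<in> space M. W x = k} x) = (\<Sum>k\<le>n. if k = W x then g k else 0)"
        by (intro sum.cong) (auto simp: indicator_def)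
      then show "g (W x) = (\<Sum>k\<le>n. g k * indicator {x \<in> space M. W x = k} x)"
        using Wn[of x] by simp
    qed
    also have "\<dots> = (\<Sum>k\<le>n. g k * q k)"
      unfolding q_def by (subst Bochner_Integration.integral_sum) (auto simp: emeasure_eq_measure)
    finally show ?thesis .
  qed
  define H where "H s = (\<Sum>k\<le>n. (1 - s) ^ k * q k)" for s :: real
  have H: "H s = expectation (\<lambda>x. \<Prod>j\<in>J. 1 - s * indicator (A j) x)" for s
    unfolding H_def prodW EW ..
  have H0: "H 0 = 1" by (simp add: H prob_space)
  have H1: "H 1 = prob {x \<in> space M. \<forall>j\<in>J. x \<notin> A j}"
  proof -
    have "H 1 = (\<Sum>k\<le>n. if k = 0 then q k else 0)"
      unfolding H_def by (intro sum.cong) auto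
    also have "\<dots> = q 0" by simp
    also have "\<dots> = prob {x \<in> space M. \<forall>j\<in>J. x \<notin> A j}"
      unfolding q_def W_def using J by (intro arg_cong[where f = prob]) auto
    finally show ?thesis .
  qed
  define V where "V i s x = (\<Prod>j\<in>J-{i}. 1 - s * indicator (A j) x)" for i x and s :: real
  have Vm [measurable]: "V i s \<in> borel_measurable M" for i s
    unfolding V_def by measurable
  have V01: "0 \<le> V i s x \<and> V i s x \<le> 1" if "0 \<le> s" "s \<le> 1" for i s x
    unfolding V_def using that by (intro conjI prod_nonneg prod_le_1) (auto simp: indicator_def)
  have Vint [simp]: "integrable M (V i s)" if "0 \<le> s" "s \<le> 1" for i s
    by (rule integrable_const_bound[of _ 1]) (use V01[OF that] in auto)
  have AVint [simp]: "integrable M (\<lambda>x. indicator (A i) x * V i s x)" if "0 \<le> s" "s \<le> 1" "i \<in> J" for i s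
    by (rule integrable_const_bound[of _ 1]) (use V01[OF that(1,2)] that in \<open>auto simp: indicator_def\<close>)
  define H' where "H' s = - (\<Sum>i\<in>J. expectation (\<lambda>x. indicator (A i) x * V i s x))" for s
  have split: "(\<Prod>j\<in>J. 1 - s * indicator (A j) x) = (1 - s * indicator (A i) x) * V i s x"
    if "i \<in> J" for i x and s :: real
    unfolding V_def using that J by (simp add: prod.remove)
  \<comment> \<open>If \<open>A i\<close> occurs, it accounts for one of the \<open>W x\<close>
    occurrences; otherwise both sides vanish, so the truncated subtraction does no harm.\<close>
  have AV: "indicator (A i) x * V i s x = indicator (A i) x * (1 - s) ^ (W x - 1)" if i: "i \<in> J" for i s x
  proof (cases "x \<in> A i")
    case True
    have "V i s x = (\<Prod>j\<in>J-{i}. if x \<in> A j then 1 - s else 1)"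
      unfolding V_def by (intro prod.cong) (auto simp: indicator_def)
    also have "\<dots> = (1 - s) ^ card ({j \<in> J. x \<in> A j} - {i})"
      using J by (simp add: prod.If_cases Int_def set_diff_eq conj_ac)
    also have "card ({j \<in> J. x \<in> A j} - {i}) = W x - 1"
      unfolding W_def using True i J by simp
    finally show ?thesis by simp
  qed simp
  have derH: "(H has_real_derivative H' s) (at s)" if s: "0 \<le> s" "s \<le> 1" for s
  proof -
    have "(H has_real_derivative (\<Sum>k\<le>n. (- real k * (1 - s) ^ (k - 1)) * q k)) (at s)"
      unfolding H_def by (auto intro!: derivative_eq_intros sum.cong simp: algebra_simps)
    also have "(\<Sum>k\<le>n. (- real k * (1 - s) ^ (k - 1)) * q k) = expectation (\<lambda>x. - real (W x) * (1 - s) ^ (W x - 1))"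
      using EW[of "\<lambda>k. - real k * (1 - s) ^ (k - 1)"] by simp
    also have "\<dots> = expectation (\<lambda>x. - (\<Sum>i\<in>J. indicator (A i) x * V i s x))"
      by (intro Bochner_Integration.integral_cong refl) (simp add: Wsum sum_distrib_right AV)
    also have "\<dots> = H' s"
      unfolding H'_def using s by (simp add: Bochner_Integration.integral_sum)
    finally show ?thesis .
  qed
  have err: "\<bar>H' s + lam * H s\<bar> \<le> \<Delta>" if s: "0 \<le> s" "s \<le> 1" for s
  proof -
    \<comment> \<open>Taking the factor of \<open>i\<close> out of the product turns
      \<open>p i * H s\<close> minus the \<open>i\<close>-th summand of \<open>- H' s\<close> into a
      covariance plus a term of second order in \<open>p i\<close>.\<close>
    have Hi: "H s = expectation (V i s) - s * expectation (\<lambda>x. indicator (A i) x * V i s x)" if "i \<in> J" for i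
    proof -
      have "H s = expectation (\<lambda>x. V i s x - s * (indicator (A i) x * V i s x))"
        unfolding H split[OF that] by (simp add: algebra_simps)
      then show ?thesis using s that by simp
    qed
    have "H' s + lam * H s = (\<Sum>i\<in>J. p i * H s - expectation (\<lambda>x. indicator (A i) x * V i s x))"
      unfolding H'_def lam_def by (simp add: sum_distrib_right sum_subtractf)
    also have "\<bar>\<dots>\<bar> \<le> (\<Sum>i\<in>J. \<bar>p i * H s - expectation (\<lambda>x. indicator (A i) x * V i s x)\<bar>)"
      by (rule sum_abs)
    also have "\<dots> \<le> \<Delta>"
      unfolding \<Delta>_def
    proof (rule sum_mono)
      fix i assume i: "i \<in> J"
      let ?e = "expectation (\<lambda>x. indicator (A i) x * V i s x)"
      have e0: "0 \<le> ?e" using V01[OF s] by (intro Bochner_Integration.integral_nonneg) auto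
      have "?e \<le> expectation (indicator (A i))"
        by (rule integral_mono[OF AVint[OF s i]])
          (use V01[OF s] i in \<open>auto simp: emeasure_eq_measure intro: mult_left_le\<close>)
      also have "\<dots> = p i" using i by (simp add: p_def)
      finally have ep: "?e \<le> p i" .
      have p0: "0 \<le> p i" by (simp add: p_def)
      \<comment> \<open>The second-order term is the source of the squared probabilities in the
        error.\<close>
      have "\<bar>p i * (s * ?e)\<bar> \<le> (p i)\<^sup>2"
        using s e0 ep p0 unfolding power2_eq_square abs_mult
        by (simp, intro mult_left_mono) (auto intro: order_trans[OF mult_left_le_one_le])
      moreover have "\<bar>?e - p i * expectation (V i s)\<bar> \<le> c i"
        using cov[OF i s] by (simp add: V_def[abs_def] p_def)
      moreover have "p i * H s - ?e = - (?e - p i * expectation (V i s)) - p i * (s * ?e)"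
        by (simp add: Hi[OF i] algebra_simps)
      ultimately show "\<bar>p i * H s - ?e\<bar> \<le> (p i)\<^sup>2 + c i" by linarith
    qed
    finally show ?thesis .
  qed
  \<comment> \<open>The integrating factor \<open>exp (lam * s)\<close> turns the approximate
    differential equation into a mean value estimate on the unit interval.\<close>
  have "\<exists>s>0. s < 1 \<and> exp (lam * 1) * H 1 - exp (lam * 0) * H 0 = (1 - 0) * (exp (lam * s) * (H' s + lam * H s))"
    by (rule MVT2) (auto intro!: derivative_eq_intros derH simp: algebra_simps)
  then obtain s where s: "0 < s" "s < 1" and eq: "exp lam * H 1 - 1 = exp (lam * s) * (H' s + lam * H s)"
    using H0 by auto
  have l0: "0 \<le> lam" unfolding lam_def p_def by (auto intro: sum_nonneg)
  \<comment> \<open>The bound \<open>exp (lam * s) \<le> exp lam\<close> is harmless: the factor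
    \<open>exp lam\<close> is divided out below, so the final error is free of it.\<close>
  have "\<bar>exp lam * H 1 - 1\<bar> \<le> exp lam * \<Delta>"
    unfolding eq abs_mult using s l0 err[of s]
    by (intro mult_mono) (auto simp: mult_left_le mult_nonneg_nonneg)
  moreover have "exp lam * H 1 - 1 = exp lam * (H 1 - exp (- lam))"
    by (simp add: algebra_simps flip: exp_add)
  ultimately have "\<bar>H 1 - exp (- lam)\<bar> \<le> \<Delta>" by (simp add: abs_mult)
  then show ?thesis unfolding H1 lam_def \<Delta>_def p_def .
qed

text \<open>\<open>dot I w (proj_perp I v x)\<close> is the part of \<open>dot I w x\<close> that is independent of \<open>dot I v x\<close>; the event
  is that replacing one by the other matters for exceeding \<open>u\<close>.\<close>

definition flip_event :: "'i set \<Rightarrow> real \<Rightarrow> ('i \<Rightarrow> real) \<Rightarrow> ('i \<Rightarrow> real) \<Rightarrow> ('i \<Rightarrow> real) set" where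
  "flip_event I u v w = {x \<in> space (std_gauss I). (u < dot I w x) \<noteq> (u < dot I w (proj_perp I v x))}"

lemma measurable_dot_proj_perp [measurable]:
  "finite I \<Longrightarrow> (\<lambda>x. dot I w (proj_perp I v x)) \<in> borel_measurable (PiM I (\<lambda>_. borel))"
  unfolding dot_proj_perp by measurable

lemma sets_flip_event [measurable]: "finite I \<Longrightarrow> flip_event I u v w \<in> sets (std_gauss I)"
  unfolding flip_event_def by measurable

section \<open>Independence of the projection and the cost of replacing one variable\<close>

text \<open>The splitting formula with integrand \<open>indicator {u<..} a * g y\<close>: the inner
  integral over \<open>a\<close> is the exceedance probability.\<close>

lemma nn_integral_indep_proj_perp:
  assumes I: "finite I" and v: "dot I v v = 1" and g [measurable]: "g \<in> borel_measurable (PiM I (\<lambda>_. borel))"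
  shows "(\<integral>\<^sup>+x. indicator {x \<in> space (std_gauss I). u < dot I v x} x * g (proj_perp I v x) \<partial>std_gauss I) =
    ennreal (measure (std_gauss I) {x \<in> space (std_gauss I). u < dot I v x}) * (\<integral>\<^sup>+x. g (proj_perp I v x) \<partial>std_gauss I)"
proof -
  interpret S: prob_space "std_gauss I" by (rule prob_space_std_gauss)
  note [simp] = I
  let ?A = "{x \<in> space (std_gauss I). u < dot I v x}"
  have A: "?A \<in> sets (std_gauss I)" by measurable
  have m: "(\<lambda>(a, y). indicator {u<..} a * g y) \<in> borel_measurable (borel \<Otimes>\<^sub>M PiM I (\<lambda>_. borel))"
    unfolding split_beta' by measurable
  have gm: "(\<lambda>x. g (proj_perp I v x)) \<in> borel_measurable (std_gauss I)" by measurable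
  have p: "(\<integral>\<^sup>+a. indicator {u<..} a \<partial>gauss) = ennreal (S.prob ?A)"
  proof -
    have "(\<integral>\<^sup>+a. indicator {u<..} a \<partial>gauss) = (\<integral>\<^sup>+x. indicator {u<..} (dot I v x) \<partial>std_gauss I)"
      by (rule nn_integral_dot_unit[symmetric]) (use v in auto)
    also have "\<dots> = (\<integral>\<^sup>+x. indicator ?A x \<partial>std_gauss I)"
      by (rule nn_integral_cong) (auto simp: indicator_def)
    also have "\<dots> = ennreal (S.prob ?A)"
      by (simp only: nn_integral_indicator[OF A] S.emeasure_eq_measure)
    finally show ?thesis .
  qed
  have "(\<integral>\<^sup>+x. indicator ?A x * g (proj_perp I v x) \<partial>std_gauss I) =
      (\<integral>\<^sup>+x. indicator {u<..} (dot I v x) * g (proj_perp I v x) \<partial>std_gauss I)"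
    by (rule nn_integral_cong) (auto simp: indicator_def)
  also have "\<dots> = (\<integral>\<^sup>+x. \<integral>\<^sup>+a. indicator {u<..} a * g (proj_perp I v x) \<partial>gauss \<partial>std_gauss I)"
    using nn_integral_std_gauss_split[OF I m v] by simp
  also have "\<dots> = (\<integral>\<^sup>+x. ennreal (S.prob ?A) * g (proj_perp I v x) \<partial>std_gauss I)"
    unfolding p[symmetric] by (intro nn_integral_cong nn_integral_multc) simp
  also have "\<dots> = ennreal (S.prob ?A) * (\<integral>\<^sup>+x. g (proj_perp I v x) \<partial>std_gauss I)"
    by (rule nn_integral_cmult[OF gm])
  finally show ?thesis .
qed

text \<open>Decompose \<open>w\<close> as \<open>r * v + s * \<psi>\<close> with
  \<open>\<psi>\<close> a unit vector orthogonal to \<open>v\<close>. The two functionals are then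
  independent standard normal variables, and for a fixed value \<open>a\<close> of the first the
  flip is the event of \<open>gauss_between\<close>. The weight \<open>g\<close> allows both the
  probability of the flip and its joint probability with an exceedance of \<open>dot I v x\<close>
  to be treated.\<close>

lemma weighted_flip_event:
  assumes I: "finite I" and v: "dot I v v = 1" and w: "dot I w w = 1" and r: "\<bar>dot I v w\<bar> \<le> 1/8" and u: "0 \<le> u"
    and g [measurable]: "g \<in> borel_measurable borel"
  shows "(\<integral>\<^sup>+x. g (dot I v x) * indicator (flip_event I u v w) x \<partial>std_gauss I) \<le>
    (\<integral>\<^sup>+a. g a * ennreal (\<bar>dot I v w\<bar> * \<bar>a\<bar> * exp (u * \<bar>a\<bar> / 8 - u\<^sup>2 / 2)) \<partial>gauss)"
proof -
  note [simp] = I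
  define r where "r = dot I v w"
  define s where "s = sqrt (1 - r\<^sup>2)"
  have r2: "r\<^sup>2 \<le> (1/8)\<^sup>2" using r unfolding r_def[symmetric] by (intro abs_le_square_iff[THEN iffD1]) simp
  have s2: "s\<^sup>2 = 1 - r\<^sup>2" unfolding s_def using r2 by (simp add: power2_eq_square)
  have s_half: "1/2 \<le> s" unfolding s_def by (rule real_le_rsqrt) (use r2 in \<open>simp add: power2_eq_square\<close>)
  have s1: "s \<le> 1" unfolding s_def by (rule real_le_lsqrt) (auto simp: r2)
  \<comment> \<open>Gram-Schmidt; \<open>|r| \<le> 1/8\<close> keeps \<open>s\<close> away from
    0.\<close>
  define \<psi> where "\<psi> i = (1/s) * (w i - r * v i)" for i
  have dpsi: "dot I \<psi> x = (dot I w x - r * dot I v x) / s" for x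
    unfolding \<psi>_def dot_simps by simp
  have p0: "dot I v \<psi> = 0"
    unfolding dot_commute[of I v \<psi>] dpsi by (simp add: r_def v dot_commute[of I w v])
  have p1: "dot I \<psi> \<psi> = 1"
  proof -
    have "dot I \<psi> \<psi> = dot I w \<psi> / s" unfolding dpsi[of \<psi>] p0 by simp
    also have "dot I w \<psi> = (1 - r\<^sup>2) / s"
      unfolding dot_commute[of I w \<psi>] dpsi by (simp add: r_def w power2_eq_square)
    finally show ?thesis unfolding s2[symmetric] using s_half by (simp add: power2_eq_square)
  qed
  have sp: "s * dot I \<psi> x = dot I w x - r * dot I v x" for x
    unfolding dpsi using s_half by simp
  define F :: "real \<Rightarrow> real \<Rightarrow> ennreal" where
    "F a b = g a * of_bool ((u < s * b + r * a) \<noteq> (u < s * b))" for a b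
  have Fm: "(\<lambda>(b, a). F b a) \<in> borel_measurable (borel \<Otimes>\<^sub>M borel)"
    unfolding F_def split_beta' by measurable
  have Fm': "(\<lambda>(b, a). F a b) \<in> borel_measurable (borel \<Otimes>\<^sub>M borel)"
    unfolding F_def split_beta' by measurable
  interpret G: prob_space gauss by (rule prob_space_gauss)
  interpret GG: pair_sigma_finite gauss gauss ..
  have "(\<integral>\<^sup>+x. g (dot I v x) * indicator (flip_event I u v w) x \<partial>std_gauss I) =
     (\<integral>\<^sup>+x. F (dot I v x) (dot I \<psi> x) \<partial>std_gauss I)"
    by (rule nn_integral_cong)
      (auto simp: F_def flip_event_def sp dot_proj_perp r_def dot_commute[of I w v] mult.commute indicator_def)
  also have "\<dots> = (\<integral>\<^sup>+b. \<integral>\<^sup>+a. F a b \<partial>gauss \<partial>gauss)"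
    by (rule nn_integral_dot_orthonormal[OF I v p1 p0 Fm])
  \<comment> \<open>The order is exchanged in order to integrate over \<open>b\<close> first, with
    \<open>a\<close> fixed.\<close>
  also have "\<dots> = (\<integral>\<^sup>+a. \<integral>\<^sup>+b. F a b \<partial>gauss \<partial>gauss)"
    by (rule GG.Fubini') (use Fm' in \<open>simp cong: measurable_cong_sets sets_pair_measure_cong\<close>)
  also have "\<dots> \<le> (\<integral>\<^sup>+a. g a * ennreal (\<bar>dot I v w\<bar> * \<bar>a\<bar> * exp (u * \<bar>a\<bar> / 8 - u\<^sup>2 / 2)) \<partial>gauss)"
  proof (rule nn_integral_mono)
    fix a
    have "(\<integral>\<^sup>+b. F a b \<partial>gauss) = g a * (\<integral>\<^sup>+b. of_bool ((u < s * b + r * a) \<noteq> (u < s * b)) \<partial>gauss)"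
      unfolding F_def by (rule nn_integral_cmult) measurable
    also have "\<dots> \<le> g a * ennreal (\<bar>r\<bar> * \<bar>a\<bar> * exp (u * \<bar>a\<bar> / 8 - u\<^sup>2 / 2))"
      using r unfolding r_def[symmetric] by (intro mult_left_mono gauss_between u s_half s1) auto
    finally show "(\<integral>\<^sup>+b. F a b \<partial>gauss) \<le> g a * ennreal (\<bar>dot I v w\<bar> * \<bar>a\<bar> * exp (u * \<bar>a\<bar> / 8 - u\<^sup>2 / 2))"
      by (simp add: r_def)
  qed
  finally show ?thesis .
qed

text \<open>By \<open>|a| \<le> exp |a|\<close> the integrand is at most a constant times one
  exponential of \<open>|a|\<close>. The parameters \<open>l = u\<close>, \<open>c = u^2\<close>
  serve for an integral restricted to \<open>a > u\<close>, and \<open>l = c = 0\<close> for an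
  unrestricted one.\<close>

lemma abs_mult_exp_gauss:
  assumes "0 \<le> K"
  shows "(\<integral>\<^sup>+a. ennreal (exp (l * \<bar>a\<bar> - c)) * ennreal (K * \<bar>a\<bar> * exp (u * \<bar>a\<bar> / 8 - u\<^sup>2 / 2)) \<partial>gauss)
    \<le> ennreal (2 * K * exp ((1 + l + u / 8)\<^sup>2 / 2 - c - u\<^sup>2 / 2))"
proof -
  let ?k = "1 + l + u / 8"
  let ?C = "K * exp (- c - u\<^sup>2 / 2)"
  have C0: "0 \<le> ?C" using assms by simp
  have "(\<integral>\<^sup>+a. ennreal (exp (l * \<bar>a\<bar> - c)) * ennreal (K * \<bar>a\<bar> * exp (u * \<bar>a\<bar> / 8 - u\<^sup>2 / 2)) \<partial>gauss)
     \<le> (\<integral>\<^sup>+a. ennreal ?C * ennreal (exp (?k * \<bar>a\<bar>)) \<partial>gauss)"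
  proof (rule nn_integral_mono)
    fix a :: real
    have "\<bar>a\<bar> \<le> exp \<bar>a\<bar>" using exp_ge_add_one_self[of "\<bar>a\<bar>"] by linarith
    then have "exp (l * \<bar>a\<bar> - c) * (K * \<bar>a\<bar> * exp (u * \<bar>a\<bar> / 8 - u\<^sup>2 / 2)) \<le>
       exp (l * \<bar>a\<bar> - c) * (K * exp \<bar>a\<bar> * exp (u * \<bar>a\<bar> / 8 - u\<^sup>2 / 2))"
      using assms by (intro mult_left_mono mult_right_mono) auto
    also have "\<dots> = K * exp ((l * \<bar>a\<bar> - c) + \<bar>a\<bar> + (u * \<bar>a\<bar> / 8 - u\<^sup>2 / 2))"
      by (simp only: exp_add) (simp only: ac_simps)
    also have "(l * \<bar>a\<bar> - c) + \<bar>a\<bar> + (u * \<bar>a\<bar> / 8 - u\<^sup>2 / 2) = (- c - u\<^sup>2 / 2) + ?k * \<bar>a\<bar>"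
      by (simp add: algebra_simps)
    also have "K * exp ((- c - u\<^sup>2 / 2) + ?k * \<bar>a\<bar>) = ?C * exp (?k * \<bar>a\<bar>)"
      by (simp only: exp_add mult.assoc)
    finally have le: "exp (l * \<bar>a\<bar> - c) * (K * \<bar>a\<bar> * exp (u * \<bar>a\<bar> / 8 - u\<^sup>2 / 2)) \<le> ?C * exp (?k * \<bar>a\<bar>)" .
    have "ennreal (exp (l * \<bar>a\<bar> - c)) * ennreal (K * \<bar>a\<bar> * exp (u * \<bar>a\<bar> / 8 - u\<^sup>2 / 2)) =
       ennreal (exp (l * \<bar>a\<bar> - c) * (K * \<bar>a\<bar> * exp (u * \<bar>a\<bar> / 8 - u\<^sup>2 / 2)))"
      using assms by (intro ennreal_mult[symmetric]) auto
    also have "\<dots> \<le> ennreal (?C * exp (?k * \<bar>a\<bar>))" using le by (rule ennreal_leI)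
    also have "\<dots> = ennreal ?C * ennreal (exp (?k * \<bar>a\<bar>))" using C0 by (intro ennreal_mult) auto
    finally show "ennreal (exp (l * \<bar>a\<bar> - c)) * ennreal (K * \<bar>a\<bar> * exp (u * \<bar>a\<bar> / 8 - u\<^sup>2 / 2)) \<le>
       ennreal ?C * ennreal (exp (?k * \<bar>a\<bar>))" .
  qed
  also have "\<dots> = ennreal ?C * (\<integral>\<^sup>+a. ennreal (exp (?k * \<bar>a\<bar>)) \<partial>gauss)"
    by (rule nn_integral_cmult) measurable
  also have "\<dots> \<le> ennreal ?C * ennreal (2 * exp (?k\<^sup>2 / 2))"
    by (intro mult_left_mono nn_integral_exp_abs_gauss) auto
  also have "\<dots> = ennreal (?C * (2 * exp (?k\<^sup>2 / 2)))"
    using C0 by (intro ennreal_mult[symmetric]) auto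
  also have "?C * (2 * exp (?k\<^sup>2 / 2)) = 2 * K * exp (?k\<^sup>2 / 2 - c - u\<^sup>2 / 2)"
  proof -
    have "?k\<^sup>2 / 2 - c - u\<^sup>2 / 2 = (- c - u\<^sup>2 / 2) + ?k\<^sup>2 / 2" by simp
    then show ?thesis by (simp only: exp_add mult.assoc)
  qed
  finally show ?thesis .
qed

text \<open>Both summands come from \<open>weighted_flip_event\<close>, with the exceedance
  indicator and with 1 as weight. The factor \<open>|dot I v w|\<close> survives and is what makes
  the sum over all pairs small; since \<open>u^2\<close> behaves like \<open>2 * ln N\<close>, the
  exponent 4/5 gives \<open>N\<close> to the power -8/5.\<close>

lemma flip_event_small_correlation:
  assumes I: "finite I" and v: "dot I v v = 1" and w: "dot I w w = 1" and r: "\<bar>dot I v w\<bar> \<le> 1/8" and u: "20 \<le> u"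
  shows "measure (std_gauss I) ({x \<in> space (std_gauss I). u < dot I v x} \<inter> flip_event I u v w) +
     measure (std_gauss I) {x \<in> space (std_gauss I). u < dot I v x} * measure (std_gauss I) (flip_event I u v w)
     \<le> 4 * \<bar>dot I v w\<bar> * exp (- (4/5) * u\<^sup>2)"
proof -
  interpret S: prob_space "std_gauss I" by (rule prob_space_std_gauss)
  note [simp] = I
  let ?A = "{x \<in> space (std_gauss I). u < dot I v x}" and ?D = "flip_event I u v w"
  let ?r = "\<bar>dot I v w\<bar>"
  have u0: "0 \<le> u" using u by simp
  note wfe = weighted_flip_event[OF I v w r u0]
  have [measurable]: "?A \<in> sets (std_gauss I)" by measurable
  have AD: "?A \<inter> ?D \<in> sets (std_gauss I)" by measurable
  have "ennreal (measure (std_gauss I) (?A \<inter> ?D)) = (\<integral>\<^sup>+x. indicator {u<..} (dot I v x) * indicator ?D x \<partial>std_gauss I)"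
  proof -
    have "ennreal (measure (std_gauss I) (?A \<inter> ?D)) = (\<integral>\<^sup>+x. indicator (?A \<inter> ?D) x \<partial>std_gauss I)"
      by (simp only: nn_integral_indicator[OF AD] S.emeasure_eq_measure)
    also have "\<dots> = (\<integral>\<^sup>+x. indicator {u<..} (dot I v x) * indicator ?D x \<partial>std_gauss I)"
      by (rule nn_integral_cong) (auto simp: indicator_def)
    finally show ?thesis .
  qed
  also have "\<dots> \<le> (\<integral>\<^sup>+a. indicator {u<..} a * ennreal (?r * \<bar>a\<bar> * exp (u * \<bar>a\<bar> / 8 - u\<^sup>2 / 2)) \<partial>gauss)"
    by (rule wfe) auto
  \<comment> \<open>Exponential tilting: the indicator of \<open>u < a\<close> is at most
    \<open>exp (u * |a| - u^2)\<close>.\<close>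
  also have "\<dots> \<le> (\<integral>\<^sup>+a. ennreal (exp (u * \<bar>a\<bar> - u\<^sup>2)) * ennreal (?r * \<bar>a\<bar> * exp (u * \<bar>a\<bar> / 8 - u\<^sup>2 / 2)) \<partial>gauss)"
  proof (rule nn_integral_mono, rule mult_right_mono)
    fix a
    have "1 \<le> exp (u * \<bar>a\<bar> - u\<^sup>2)" if "u < a"
      using that u0 by (auto simp: power2_eq_square intro!: mult_left_mono)
    then show "indicator {u<..} a \<le> ennreal (exp (u * \<bar>a\<bar> - u\<^sup>2))"
      by (auto simp: indicator_def simp flip: ennreal_1 intro!: ennreal_leI)
  qed auto
  also have "\<dots> \<le> ennreal (2 * ?r * exp ((1 + u + u / 8)\<^sup>2 / 2 - u\<^sup>2 - u\<^sup>2 / 2))"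
    by (rule abs_mult_exp_gauss) auto
  finally have "measure (std_gauss I) (?A \<inter> ?D) \<le> 2 * ?r * exp ((1 + u + u / 8)\<^sup>2 / 2 - u\<^sup>2 - u\<^sup>2 / 2)"
    by (simp add: ennreal_le_iff)
  also have "\<dots> \<le> 2 * ?r * exp (- (4/5) * u\<^sup>2)"
  proof (intro mult_left_mono, subst exp_le_cancel_iff)
    \<comment> \<open>From \<open>u \<ge> 20\<close> follows \<open>1 \<le> u / 20\<close>, and
      \<open>1/20 + 9/8 = 47/40\<close>. The resulting coefficient \<open>2209/3200 - 3/2\<close> is
      just below -4/5.\<close>
    have le: "(1 + u + u / 8)\<^sup>2 \<le> (47/40 * u)\<^sup>2" using u by (intro power_mono) auto
    show "(1 + u + u / 8)\<^sup>2 / 2 - u\<^sup>2 - u\<^sup>2 / 2 \<le> - (4/5) * u\<^sup>2"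
    proof -
      have "(47/40 * u)\<^sup>2 = 2209/1600 * u\<^sup>2" by (simp add: power2_eq_square)
      then show ?thesis using le zero_le_power2[of u] by linarith
    qed
  qed auto
  finally have 1: "measure (std_gauss I) (?A \<inter> ?D) \<le> 2 * ?r * exp (- (4/5) * u\<^sup>2)" .
  have "ennreal (measure (std_gauss I) ?D) = (\<integral>\<^sup>+x. (\<lambda>_. 1) (dot I v x) * indicator ?D x \<partial>std_gauss I)"
    using nn_integral_indicator[OF sets_flip_event[OF I]] by (simp add: S.emeasure_eq_measure)
  also have "\<dots> \<le> (\<integral>\<^sup>+a. 1 * ennreal (?r * \<bar>a\<bar> * exp (u * \<bar>a\<bar> / 8 - u\<^sup>2 / 2)) \<partial>gauss)"
    by (rule wfe) auto
  also have "\<dots> \<le> ennreal (2 * ?r * exp ((1 + 0 + u / 8)\<^sup>2 / 2 - 0 - u\<^sup>2 / 2))"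
    using abs_mult_exp_gauss[of ?r 0 0 u] by simp
  finally have D: "measure (std_gauss I) ?D \<le> 2 * ?r * exp ((1 + u / 8)\<^sup>2 / 2 - u\<^sup>2 / 2)"
    by (simp add: ennreal_le_iff)
  have "measure (std_gauss I) ?A * measure (std_gauss I) ?D \<le> exp (- (u\<^sup>2 / 2)) * (2 * ?r * exp ((1 + u / 8)\<^sup>2 / 2 - u\<^sup>2 / 2))"
    by (intro mult_mono D std_gauss_tail) (use v u0 in auto)
  also have "\<dots> = 2 * ?r * exp ((1 + u / 8)\<^sup>2 / 2 - u\<^sup>2)"
    by (simp add: exp_add[symmetric] flip: mult.assoc)
  also have "\<dots> \<le> 2 * ?r * exp (- (4/5) * u\<^sup>2)"
  proof (intro mult_left_mono, subst exp_le_cancel_iff)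
    \<comment> \<open>Here \<open>1 + u / 8 \<le> u / 2\<close> suffices, since it leaves the
      coefficient \<open>1/8 - 1 = -7/8\<close>.\<close>
    have le: "(1 + u / 8)\<^sup>2 \<le> (u / 2)\<^sup>2" using u by (intro power_mono) auto
    show "(1 + u / 8)\<^sup>2 / 2 - u\<^sup>2 \<le> - (4/5) * u\<^sup>2"
    proof -
      have "(u / 2)\<^sup>2 = 1/4 * u\<^sup>2" by (simp add: power2_eq_square)
      then show ?thesis using le zero_le_power2[of u] by linarith
    qed
  qed auto
  finally show ?thesis using 1 by simp
qed

text \<open>A flip forces \<open>dot I w x\<close> or its projected version to exceed
  \<open>u\<close>. Together with \<open>u < dot I v x\<close>, the first case is a joint tail and
  the second a product of two tails by independence; without it, two single tails remain.\<close>

lemma flip_event_any_correlation: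
  assumes I: "finite I" and v: "dot I v v = 1" and w: "dot I w w = 1" and r: "\<bar>dot I v w\<bar> \<le> \<rho>" "\<rho> \<le> 1" and u: "0 \<le> u"
  shows "measure (std_gauss I) ({x \<in> space (std_gauss I). u < dot I v x} \<inter> flip_event I u v w) +
     measure (std_gauss I) {x \<in> space (std_gauss I). u < dot I v x} * measure (std_gauss I) (flip_event I u v w)
     \<le> 4 * exp (- (u\<^sup>2 / (1 + \<rho>)))"
proof -
  interpret S: prob_space "std_gauss I" by (rule prob_space_std_gauss)
  note [simp] = I
  let ?A = "{x \<in> space (std_gauss I). u < dot I v x}" and ?D = "flip_event I u v w"
  let ?B = "{x \<in> space (std_gauss I). u < dot I w x}"
  let ?w = "\<lambda>i. w i - dot I v w * v i"
  let ?C = "{x \<in> space (std_gauss I). u < dot I w (proj_perp I v x)}"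
  let ?q = "exp (- (u\<^sup>2 / 2))" and ?e = "exp (- (u\<^sup>2 / (1 + \<rho>)))"
  have [measurable]: "?A \<in> sets (std_gauss I)" "?B \<in> sets (std_gauss I)" "?C \<in> sets (std_gauss I)" by measurable
  have Cm: "?C \<in> sets (std_gauss I)" and AC: "?A \<inter> ?C \<in> sets (std_gauss I)"
    by measurable
  have \<rho>0: "0 \<le> \<rho>" using r by linarith
  have A: "S.prob ?A \<le> ?q" and B: "S.prob ?B \<le> ?q" by (intro std_gauss_tail, use v w u in auto)+
  \<comment> \<open>The projected functional is the functional of the residual of \<open>w\<close>,
    whose norm is at most 1.\<close>
  have ww: "dot I ?w ?w \<le> 1"
  proof -
    have "dot I ?w ?w = 1 - (dot I v w)\<^sup>2"
      by (simp add: dot_simps v w dot_commute[of I w v] power2_eq_square)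
    then show ?thesis by simp
  qed
  have Ceq: "?C = {x \<in> space (std_gauss I). u < dot I ?w x}"
    unfolding dot_proj_perp dot_diff_left dot_scale_left dot_commute[of I w v] by (simp add: mult.commute)
  have C: "S.prob ?C \<le> ?q" unfolding Ceq by (rule std_gauss_tail) (use ww u in auto)
  have indep: "S.prob (?A \<inter> ?C) = S.prob ?A * S.prob ?C"
  proof -
    have "ennreal (S.prob (?A \<inter> ?C)) = (\<integral>\<^sup>+x. indicator (?A \<inter> ?C) x \<partial>std_gauss I)"
      by (simp only: nn_integral_indicator[OF AC] S.emeasure_eq_measure)
    also have "\<dots> = (\<integral>\<^sup>+x. indicator ?A x * indicator {u<..} (dot I w (proj_perp I v x)) \<partial>std_gauss I)"
      by (rule nn_integral_cong) (auto simp: indicator_def)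
    also have "\<dots> = ennreal (S.prob ?A) * (\<integral>\<^sup>+x. indicator {u<..} (dot I w (proj_perp I v x)) \<partial>std_gauss I)"
      by (rule nn_integral_indep_proj_perp[OF I v]) measurable
    also have "(\<integral>\<^sup>+x. indicator {u<..} (dot I w (proj_perp I v x)) \<partial>std_gauss I) = (\<integral>\<^sup>+x. indicator ?C x \<partial>std_gauss I)"
      by (rule nn_integral_cong) (auto simp: indicator_def)
    also have "\<dots> = ennreal (S.prob ?C)"
      by (simp only: nn_integral_indicator[OF Cm] S.emeasure_eq_measure)
    finally show ?thesis by (simp add: ennreal_mult[symmetric])
  qed
  \<comment> \<open>Products of two single tails are absorbed into the joint tail bound, using
    \<open>\<rho> \<ge> 0\<close>.\<close>
  have qe: "?q * ?q \<le> ?e"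
  proof -
    have "u\<^sup>2 / (1 + \<rho>) \<le> u\<^sup>2 / 1" using \<rho>0 by (intro divide_left_mono) auto
    then show ?thesis by (simp add: exp_add[symmetric])
  qed
  have "S.prob (?A \<inter> ?D) \<le> S.prob ((?A \<inter> ?B) \<union> (?A \<inter> ?C))"
    by (rule S.finite_measure_mono, force simp: flip_event_def, measurable)
  also have "\<dots> \<le> S.prob (?A \<inter> ?B) + S.prob (?A \<inter> ?C)"
    by (rule measure_Un_le; measurable)
  also have "?A \<inter> ?B = {x \<in> space (std_gauss I). u < dot I v x \<and> u < dot I w x}" by auto
  also have "S.prob \<dots> \<le> ?e"
    by (rule std_gauss_joint_tail) (use v w r u \<rho>0 in auto)
  also have "S.prob (?A \<inter> ?C) \<le> ?q * ?q" unfolding indep by (intro mult_mono A C) auto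
  finally have 1: "S.prob (?A \<inter> ?D) \<le> ?e + ?q * ?q" by simp
  have "S.prob ?D \<le> S.prob (?B \<union> ?C)"
    by (rule S.finite_measure_mono, force simp: flip_event_def, measurable)
  also have "\<dots> \<le> S.prob ?B + S.prob ?C" by (rule measure_Un_le; measurable)
  also have "\<dots> \<le> 2 * ?q" using B C by simp
  finally have "S.prob ?A * S.prob ?D \<le> ?q * (2 * ?q)" by (intro mult_mono A) auto
  then show ?thesis using 1 qe by linarith
qed

section \<open>Covariances and the total error of the Poisson approximation\<close>

text \<open>After all other functionals are replaced by their projected versions, the product
  \<open>F0\<close> is independent of \<open>A i\<close> and the covariance is 0. The bound is the
  cost of this replacement in each of the two expectations.\<close>

lemma cov_exceedance:
  fixes u s :: real
  assumes I: "finite I" and J: "finite J" and i: "i \<in> J" and unit: "\<And>j. j \<in> J \<Longrightarrow> dot I (\<phi> j) (\<phi> j) = 1"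
    and s: "0 \<le> s" "s \<le> 1"
  defines "A \<equiv> \<lambda>j. {x \<in> space (std_gauss I). u < dot I (\<phi> j) x}"
  shows "\<bar>integral\<^sup>L (std_gauss I) (\<lambda>x. indicator (A i) x * (\<Prod>j\<in>J-{i}. 1 - s * indicator (A j) x)) -
       measure (std_gauss I) (A i) * integral\<^sup>L (std_gauss I) (\<lambda>x. \<Prod>j\<in>J-{i}. 1 - s * indicator (A j) x)\<bar>
     \<le> (\<Sum>j\<in>J-{i}. measure (std_gauss I) (A i \<inter> flip_event I u (\<phi> i) (\<phi> j)) +
          measure (std_gauss I) (A i) * measure (std_gauss I) (flip_event I u (\<phi> i) (\<phi> j)))"
proof -
  interpret S: prob_space "std_gauss I" by (rule prob_space_std_gauss)
  note [simp] = I
  let ?v = "\<phi> i" and ?p = "S.prob (A i)"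
  let ?D = "\<lambda>j. flip_event I u (\<phi> i) (\<phi> j)"
  have Am [measurable]: "A j \<in> S.events" for j unfolding A_def by measurable
  have Dm [measurable]: "?D j \<in> S.events" for j by (rule sets_flip_event[OF I])
  define g where "g y = (\<Prod>j\<in>J-{i}. 1 - s * of_bool (u < dot I (\<phi> j) y))" for y
  define F where "F x = (\<Prod>j\<in>J-{i}. 1 - s * indicator (A j) x)" for x
  define F0 where "F0 x = g (proj_perp I ?v x)" for x
  have gm [measurable]: "g \<in> borel_measurable (PiM I (\<lambda>_. borel))" unfolding g_def by measurable
  have Fm [measurable]: "F \<in> borel_measurable (std_gauss I)" unfolding F_def by measurable
  have F0m [measurable]: "F0 \<in> borel_measurable (std_gauss I)" unfolding F0_def by measurable
  have g01: "0 \<le> g y" "g y \<le> 1" for y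
    unfolding g_def using s by (intro prod_nonneg prod_le_1; auto)+
  have F01: "0 \<le> F y" "F y \<le> 1" for y
    unfolding F_def using s by (intro prod_nonneg prod_le_1; auto simp: indicator_def)+
  have F001: "0 \<le> F0 y" "F0 y \<le> 1" for y unfolding F0_def by (simp_all add: g01)
  have iF: "integrable (std_gauss I) F" and iF0: "integrable (std_gauss I) F0"
    by (rule S.integrable_const_bound[of _ 1]; use F01 F001 in simp)+
  have iAF: "integrable (std_gauss I) (\<lambda>x. indicator (A i) x * F x)" and iAF0: "integrable (std_gauss I) (\<lambda>x. indicator (A i) x * F0 x)"
    by (rule S.integrable_const_bound[of _ 1]; use F01 F001 in \<open>simp add: indicator_def\<close>)+
  have indep: "S.expectation (\<lambda>x. indicator (A i) x * F0 x) = ?p * S.expectation F0"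
  proof -
    have "ennreal (S.expectation (\<lambda>x. indicator (A i) x * F0 x)) = (\<integral>\<^sup>+x. ennreal (indicator (A i) x * F0 x) \<partial>std_gauss I)"
      by (rule nn_integral_eq_integral[symmetric, OF iAF0]) (use F001 in auto)
    also have "\<dots> = (\<integral>\<^sup>+x. indicator (A i) x * ennreal (g (proj_perp I ?v x)) \<partial>std_gauss I)"
      by (rule nn_integral_cong) (auto simp: indicator_def F0_def)
    also have "\<dots> = ennreal ?p * (\<integral>\<^sup>+x. ennreal (g (proj_perp I ?v x)) \<partial>std_gauss I)"
      unfolding A_def by (rule nn_integral_indep_proj_perp[OF I unit[OF i]]) measurable
    also have "(\<integral>\<^sup>+x. ennreal (g (proj_perp I ?v x)) \<partial>std_gauss I) = ennreal (S.expectation F0)"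
      unfolding F0_def[symmetric] by (rule nn_integral_eq_integral[OF iF0]) (use F001 in auto)
    also have "ennreal ?p * ennreal (S.expectation F0) = ennreal (?p * S.expectation F0)"
      by (rule ennreal_mult[symmetric]) (use F001 in \<open>auto intro: Bochner_Integration.integral_nonneg\<close>)
    finally show ?thesis
      by (subst (asm) ennreal_inj) (use F001 in \<open>auto intro!: Bochner_Integration.integral_nonneg mult_nonneg_nonneg\<close>)
  qed
  \<comment> \<open>All factors lie in the unit interval, so two products differ by at most the sum
    of the differences of their factors; each of these is at most the indicator of a flip.\<close>
  have diff: "\<bar>F x - F0 x\<bar> \<le> (\<Sum>j\<in>J-{i}. indicator (?D j) x)" if x: "x \<in> space (std_gauss I)" for x
  proof -
    have "norm (F x - F0 x) \<le> (\<Sum>j\<in>J-{i}. norm ((1 - s * indicator (A j) x) - (1 - s * of_bool (u < dot I (\<phi> j) (proj_perp I ?v x)))))"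
      unfolding F_def F0_def g_def by (rule norm_prod_diff) (use s in \<open>auto simp: indicator_def\<close>)
    also have "\<dots> \<le> (\<Sum>j\<in>J-{i}. indicator (?D j) x)"
      by (rule sum_mono) (use s x in \<open>auto simp: indicator_def A_def flip_event_def\<close>)
    finally show ?thesis by simp
  qed
  have iD: "integrable (std_gauss I) (\<lambda>x. indicator (A i) x * (\<Sum>j\<in>J-{i}. indicator (?D j) x) :: real)"
    "integrable (std_gauss I) (\<lambda>x. \<Sum>j\<in>J-{i}. indicator (?D j) x :: real)"
    unfolding sum_distrib_left indicator_inter_arith[symmetric]
    by (auto intro!: Bochner_Integration.integrable_sum simp: S.emeasure_eq_measure simp del: sets_std_gauss)
  have ED: "S.expectation (\<lambda>x. \<Sum>j\<in>J-{i}. indicator (?D j) x) = (\<Sum>j\<in>J-{i}. S.prob (?D j))"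
    by (subst Bochner_Integration.integral_sum) (auto simp: S.emeasure_eq_measure simp del: sets_std_gauss)
  have EAD: "S.expectation (\<lambda>x. indicator (A i) x * (\<Sum>j\<in>J-{i}. indicator (?D j) x)) = (\<Sum>j\<in>J-{i}. S.prob (A i \<inter> ?D j))"
    unfolding sum_distrib_left indicator_inter_arith[symmetric]
    by (subst Bochner_Integration.integral_sum) (auto simp: S.emeasure_eq_measure simp del: sets_std_gauss)
  have "\<bar>S.expectation (\<lambda>x. indicator (A i) x * F x) - S.expectation (\<lambda>x. indicator (A i) x * F0 x)\<bar> =
     \<bar>S.expectation (\<lambda>x. indicator (A i) x * F x - indicator (A i) x * F0 x)\<bar>"
    using iAF iAF0 by simp
  also have "\<dots> \<le> S.expectation (\<lambda>x. \<bar>indicator (A i) x * F x - indicator (A i) x * F0 x\<bar>)"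
    by (rule integral_abs_bound)
  also have "\<dots> \<le> S.expectation (\<lambda>x. indicator (A i) x * (\<Sum>j\<in>J-{i}. indicator (?D j) x))"
    by (rule integral_mono[OF _ iD(1)]) (use iAF iAF0 diff in \<open>auto simp: indicator_def\<close>)
  finally have 1: "\<bar>S.expectation (\<lambda>x. indicator (A i) x * F x) - S.expectation (\<lambda>x. indicator (A i) x * F0 x)\<bar> \<le> (\<Sum>j\<in>J-{i}. S.prob (A i \<inter> ?D j))"
    by (simp only: EAD)
  have "\<bar>S.expectation F - S.expectation F0\<bar> = \<bar>S.expectation (\<lambda>x. F x - F0 x)\<bar>"
    using iF iF0 by simp
  also have "\<dots> \<le> S.expectation (\<lambda>x. \<bar>F x - F0 x\<bar>)"
    by (rule integral_abs_bound)
  also have "\<dots> \<le> S.expectation (\<lambda>x. \<Sum>j\<in>J-{i}. indicator (?D j) x)"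
    by (rule integral_mono[OF _ iD(2)]) (use iF iF0 diff in auto)
  finally have "\<bar>S.expectation F - S.expectation F0\<bar> \<le> (\<Sum>j\<in>J-{i}. S.prob (?D j))"
    by (simp only: ED)
  then have 2: "\<bar>?p * (S.expectation F - S.expectation F0)\<bar> \<le> ?p * (\<Sum>j\<in>J-{i}. S.prob (?D j))"
    unfolding abs_mult by (simp add: mult_left_mono)
  have "S.expectation (\<lambda>x. indicator (A i) x * F x) - ?p * S.expectation F =
    (S.expectation (\<lambda>x. indicator (A i) x * F x) - S.expectation (\<lambda>x. indicator (A i) x * F0 x)) -
     ?p * (S.expectation F - S.expectation F0)"
    unfolding indep by (simp add: algebra_simps)
  then have "\<bar>S.expectation (\<lambda>x. indicator (A i) x * F x) - ?p * S.expectation F\<bar> \<le>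
     (\<Sum>j\<in>J-{i}. S.prob (A i \<inter> ?D j)) + ?p * (\<Sum>j\<in>J-{i}. S.prob (?D j))"
    using 1 2 by linarith
  also have "\<dots> = (\<Sum>j\<in>J-{i}. S.prob (A i \<inter> ?D j) + ?p * S.prob (?D j))"
    by (simp add: sum.distrib sum_distrib_left)
  finally show ?thesis unfolding F_def .
qed

lemma measure_dot_unit:
  assumes "finite I" "dot I v v = 1"
  shows "measure (std_gauss I) {x \<in> space (std_gauss I). u < dot I v x} = measure gauss {u<..}"
proof -
  note [simp] = assms(1)
  interpret S: prob_space "std_gauss I" by (rule prob_space_std_gauss)
  interpret G: prob_space gauss by (rule prob_space_gauss)
  let ?A = "{x \<in> space (std_gauss I). u < dot I v x}"
  have A: "?A \<in> sets (std_gauss I)" by measurable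
  have "ennreal (S.prob ?A) = (\<integral>\<^sup>+x. indicator ?A x \<partial>std_gauss I)"
    by (simp only: nn_integral_indicator[OF A] S.emeasure_eq_measure)
  also have "\<dots> = (\<integral>\<^sup>+x. indicator {u<..} (dot I v x) \<partial>std_gauss I)"
    by (rule nn_integral_cong) (auto simp: indicator_def)
  also have "\<dots> = (\<integral>\<^sup>+a. indicator {u<..} a \<partial>gauss)"
    by (rule nn_integral_dot_unit) (use assms in auto)
  also have "\<dots> = ennreal (G.prob {u<..})"
    by (subst nn_integral_indicator) (auto simp: G.emeasure_eq_measure)
  finally show ?thesis by simp
qed

text \<open>The Poisson approximation with the flip costs as covariance bounds. The three error
  terms stem from the squared probabilities, the pairs with correlation at most 1/8 and the
  remaining pairs.\<close>

lemma std_gauss_max_approximation: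
  fixes u b \<rho> :: real
  assumes I: "finite I" and J: "finite J" and unit: "\<And>j. j \<in> J \<Longrightarrow> dot I (\<phi> j) (\<phi> j) = 1"
    and \<rho>: "\<And>i j. i \<in> J \<Longrightarrow> j \<in> J \<Longrightarrow> i \<noteq> j \<Longrightarrow> \<bar>dot I (\<phi> i) (\<phi> j)\<bar> \<le> \<rho>" "\<rho> \<le> 1"
    and b: "\<And>i. i \<in> J \<Longrightarrow> (\<Sum>j\<in>J. (dot I (\<phi> i) (\<phi> j))\<^sup>2) \<le> b"
    and u: "20 \<le> u"
  shows "\<bar>measure (std_gauss I) {x \<in> space (std_gauss I). \<forall>j\<in>J. dot I (\<phi> j) x \<le> u} - exp (- (card J * measure gauss {u<..}))\<bar>
    \<le> card J * exp (- u\<^sup>2) + 4 * real (card J) * sqrt (card J * b) * exp (- (4/5) * u\<^sup>2)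
      + 256 * real (card J) * b * exp (- (u\<^sup>2 / (1 + \<rho>)))"
proof -
  interpret S: prob_space "std_gauss I" by (rule prob_space_std_gauss)
  note [simp] = I
  define A where "A j = {x \<in> space (std_gauss I). u < dot I (\<phi> j) x}" for j
  let ?D = "\<lambda>i j. flip_event I u (\<phi> i) (\<phi> j)"
  let ?r = "\<lambda>i j. dot I (\<phi> i) (\<phi> j)"
  let ?e = "exp (- (u\<^sup>2 / (1 + \<rho>)))" and ?h = "exp (- (4/5) * u\<^sup>2)"
  define c where "c i = (\<Sum>j\<in>J-{i}. S.prob (A i \<inter> ?D i j) + S.prob (A i) * S.prob (?D i j))" for i
  have u0: "0 \<le> u" using u by simp
  have Am [measurable]: "A j \<in> S.events" for j unfolding A_def by measurable
  have pA: "S.prob (A j) = measure gauss {u<..}" if "j \<in> J" for j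
    unfolding A_def by (rule measure_dot_unit[OF I unit[OF that]])
  have "\<bar>S.prob {x \<in> space (std_gauss I). \<forall>j\<in>J. x \<notin> A j} - exp (- (\<Sum>j\<in>J. S.prob (A j)))\<bar> \<le> (\<Sum>i\<in>J. (S.prob (A i))\<^sup>2 + c i)"
  proof (rule S.poisson_approximation[OF J Am])
    show "\<bar>S.expectation (\<lambda>x. indicator (A i) x * (\<Prod>j\<in>J-{i}. 1 - s * indicator (A j) x)) -
       S.prob (A i) * S.expectation (\<lambda>x. \<Prod>j\<in>J-{i}. 1 - s * indicator (A j) x)\<bar> \<le> c i" if "i \<in> J" "0 \<le> s" "s \<le> 1" for i s
      unfolding c_def A_def by (rule cov_exceedance[OF I J \<open>i \<in> J\<close> unit that(2,3)])
  qed
  also have "(\<Sum>j\<in>J. S.prob (A j)) = card J * measure gauss {u<..}"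
    by (simp add: pA)
  also have "{x \<in> space (std_gauss I). \<forall>j\<in>J. x \<notin> A j} = {x \<in> space (std_gauss I). \<forall>j\<in>J. dot I (\<phi> j) x \<le> u}"
    by (auto simp: A_def not_less)
  also have "(\<Sum>i\<in>J. (S.prob (A i))\<^sup>2 + c i) \<le> (\<Sum>i\<in>J. exp (- u\<^sup>2) + (4 * sqrt (card J * b) * ?h + 256 * b * ?e))"
  proof (rule sum_mono, rule add_mono)
    fix i assume i: "i \<in> J"
    have "(S.prob (A i))\<^sup>2 \<le> (exp (- (u\<^sup>2 / 2)))\<^sup>2"
      unfolding A_def by (intro power_mono std_gauss_tail) (use unit[OF i] u0 in auto)
    also have "\<dots> = exp (- u\<^sup>2)" by (simp add: power2_eq_square exp_add[symmetric])
    finally show "(S.prob (A i))\<^sup>2 \<le> exp (- u\<^sup>2)" .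
    have "c i \<le> (\<Sum>j\<in>J-{i}. 4 * \<bar>?r i j\<bar> * ?h + 256 * (?r i j)\<^sup>2 * ?e)"
      unfolding c_def
    proof (rule sum_mono)
      fix j assume j: "j \<in> J - {i}"
      show "S.prob (A i \<inter> ?D i j) + S.prob (A i) * S.prob (?D i j) \<le> 4 * \<bar>?r i j\<bar> * ?h + 256 * (?r i j)\<^sup>2 * ?e"
      proof (cases "\<bar>?r i j\<bar> \<le> 1/8")
        case True
        have "S.prob (A i \<inter> ?D i j) + S.prob (A i) * S.prob (?D i j) \<le> 4 * \<bar>?r i j\<bar> * ?h"
          unfolding A_def by (rule flip_event_small_correlation) (use i j unit True u in auto)
        then show ?thesis by (simp add: add_increasing2)
      next
        case False
        have "S.prob (A i \<inter> ?D i j) + S.prob (A i) * S.prob (?D i j) \<le> 4 * ?e"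
          unfolding A_def by (rule flip_event_any_correlation) (use i j unit \<rho> u in auto)
        \<comment> \<open>The number of larger correlations is controlled by the sum of squares:
          \<open>256 * (1/8)^2 = 4\<close>.\<close>
        also have "4 * ?e \<le> 256 * (?r i j)\<^sup>2 * ?e"
        proof (intro mult_right_mono)
          have "(1/8)\<^sup>2 \<le> \<bar>?r i j\<bar>\<^sup>2" using False by (intro power_mono) auto
          then show "4 \<le> 256 * (?r i j)\<^sup>2" by (simp add: power2_eq_square)
        qed simp
        also have "\<dots> \<le> 4 * \<bar>?r i j\<bar> * ?h + 256 * (?r i j)\<^sup>2 * ?e" by simp
        finally show ?thesis .
      qed
    qed
    also have "\<dots> \<le> (\<Sum>j\<in>J. 4 * \<bar>?r i j\<bar> * ?h + 256 * (?r i j)\<^sup>2 * ?e)"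
      by (rule sum_mono2) (use J in auto)
    also have "\<dots> = 4 * (\<Sum>j\<in>J. \<bar>?r i j\<bar>) * ?h + 256 * (\<Sum>j\<in>J. (?r i j)\<^sup>2) * ?e"
      by (simp add: sum.distrib sum_distrib_left sum_distrib_right)
    also have "\<dots> \<le> 4 * sqrt (card J * b) * ?h + 256 * b * ?e"
    proof (intro add_mono mult_right_mono mult_left_mono b[OF i])
      \<comment> \<open>The Cauchy-Schwarz inequality passes from the sum of squares, bounded by
        \<open>b\<close>, to the sum of absolute values.\<close>
      have "(\<Sum>j\<in>J. \<bar>?r i j\<bar> * 1)\<^sup>2 \<le> (\<Sum>j\<in>J. \<bar>?r i j\<bar>\<^sup>2) * (\<Sum>j\<in>J. 1\<^sup>2)"
        by (rule Cauchy_Schwarz_ineq_sum)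
      also have "\<dots> \<le> b * card J" using b[OF i] by (simp add: mult_right_mono)
      finally show "(\<Sum>j\<in>J. \<bar>?r i j\<bar>) \<le> sqrt (card J * b)"
        by (intro real_le_rsqrt) (simp add: mult.commute)
    qed auto
    finally show "c i \<le> 4 * sqrt (card J * b) * ?h + 256 * b * ?e" .
  qed
  also have "\<dots> = card J * exp (- u\<^sup>2) + 4 * real (card J) * sqrt (card J * b) * ?h + 256 * real (card J) * b * ?e"
    by (simp add: algebra_simps)
  finally show ?thesis .
qed

section \<open>The normal tail at the threshold\<close>

text \<open>The function \<open>- std_normal_density x / x\<close> is an antiderivative of
  \<open>f\<close>, and on the half-line from \<open>u\<close> the factor \<open>1 + 1 / x^2\<close>
  lies between 1 and \<open>1 + 1 / u^2\<close>.\<close>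

lemma mills_ratio:
  assumes u: "0 < u"
  shows "measure gauss {u<..} \<le> std_normal_density u / u"
    and "std_normal_density u / u \<le> (1 + 1 / u\<^sup>2) * measure gauss {u<..}"
proof -
  interpret G: prob_space gauss by (rule prob_space_gauss)
  define f where "f x = std_normal_density x * (1 + 1 / x\<^sup>2)" for x
  have fm [measurable]: "f \<in> borel_measurable borel" unfolding f_def by measurable
  have lim: "((\<lambda>x. - std_normal_density x / x) \<longlongrightarrow> 0) at_top"
    unfolding std_normal_density_def by real_asymp
  have der: "((\<lambda>x. - std_normal_density x / x) has_real_derivative f x) (at x)" if "u \<le> x" for x
  proof -
    define c where "c = 1 / sqrt (2 * pi)"
    have "((\<lambda>x. c * (- exp (- x\<^sup>2 / 2) / x)) has_real_derivative c * (exp (- x\<^sup>2 / 2) * (1 + 1 / x\<^sup>2))) (at x)"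
      by (rule DERIV_cmult) (use that u in \<open>auto intro!: derivative_eq_intros simp: field_simps power2_eq_square\<close>)
    then show ?thesis unfolding f_def std_normal_density_def c_def by (simp add: mult.assoc)
  qed
  have "(\<integral>\<^sup>+x. ennreal (f x) * indicator {u..} x \<partial>lborel) = 0 - (- std_normal_density u / u)"
    by (rule nn_integral_FTC_atLeast[OF fm der _ lim]) (auto simp: f_def)
  then have I: "(\<integral>\<^sup>+x. ennreal (f x) * indicator {u..} x \<partial>lborel) = ennreal (std_normal_density u / u)"
    by simp
  \<comment> \<open>The fundamental theorem of calculus yields a closed half-line; the end point is
    a null set.\<close>
  have P: "ennreal (measure gauss {u<..}) = (\<integral>\<^sup>+x. ennreal (std_normal_density x) * indicator {u..} x \<partial>lborel)"
  proof -
    have "ennreal (measure gauss {u<..}) = (\<integral>\<^sup>+x. ennreal (std_normal_density x) * indicator {u<..} x \<partial>lborel)"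
      by (subst G.emeasure_eq_measure[symmetric]) (simp add: emeasure_density)
    also have "\<dots> = (\<integral>\<^sup>+x. ennreal (std_normal_density x) * indicator {u..} x \<partial>lborel)"
      by (rule nn_integral_cong_AE, rule AE_I'[of "{u}"]) (auto simp: indicator_def null_sets_def)
    finally show ?thesis .
  qed
  have "ennreal (measure gauss {u<..}) \<le> ennreal (std_normal_density u / u)"
    unfolding P I[symmetric]
    by (rule nn_integral_mono) (auto simp: indicator_def f_def distrib_left intro!: ennreal_leI)
  then show "measure gauss {u<..} \<le> std_normal_density u / u"
    using u by (subst (asm) ennreal_le_iff) auto
  have "ennreal (std_normal_density u / u) \<le> (\<integral>\<^sup>+x. ennreal (1 + 1 / u\<^sup>2) * (ennreal (std_normal_density x) * indicator {u..} x) \<partial>lborel)"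
    unfolding I[symmetric]
  proof (rule nn_integral_mono)
    fix x
    show "ennreal (f x) * indicator {u..} x \<le> ennreal (1 + 1 / u\<^sup>2) * (ennreal (std_normal_density x) * indicator {u..} x)"
    proof (cases "u \<le> x")
      case True
      then have "1 / x\<^sup>2 \<le> 1 / u\<^sup>2" using u by (intro divide_left_mono power_mono) auto
      then have "f x \<le> (1 + 1 / u\<^sup>2) * std_normal_density x"
        unfolding f_def by (subst mult.commute, intro mult_right_mono) auto
      then show ?thesis using True by (simp add: ennreal_mult[symmetric] ennreal_leI del: ennreal_plus)
    qed simp
  qed
  also have "\<dots> = ennreal (1 + 1 / u\<^sup>2) * ennreal (measure gauss {u<..})"
    unfolding P by (rule nn_integral_cmult) measurable
  also have "\<dots> = ennreal ((1 + 1 / u\<^sup>2) * measure gauss {u<..})"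
    by (rule ennreal_mult[symmetric]) auto
  finally show "std_normal_density u / u \<le> (1 + 1 / u\<^sup>2) * measure gauss {u<..}"
    by (subst (asm) ennreal_le_iff) auto
qed

text \<open>The Gumbel normalization at \<open>z\<close>, with the number of elements replaced by a
  real variable so that limits at infinity can be taken in it.\<close>

definition normal_max_threshold :: "real \<Rightarrow> real \<Rightarrow> real" where
  "normal_max_threshold z x = 1 / sqrt (2 * ln x) * z +
     (sqrt (2 * ln x) - (ln (ln x) + ln (4 * pi)) / (2 * sqrt (2 * ln x)))"

lemma normal_max_threshold_at_top: "filterlim (normal_max_threshold z) at_top at_top"
  unfolding normal_max_threshold_def by real_asymp

text \<open>Write the threshold as \<open>s + w / s\<close> with \<open>s^2 = 2 * ln x\<close>. Its
  square is \<open>2 * ln x + 2 * w + (w / s)^2\<close>: the first term cancels the factor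
  \<open>x\<close>, and \<open>exp (- w)\<close> is \<open>exp (- z)\<close> times
  \<open>s * sqrt (2 * pi)\<close>, which compensates the denominators. What is left are
  \<open>s / T\<close>, tending to 1, and \<open>w / s\<close>, tending to 0.\<close>

lemma density_at_threshold:
  "((\<lambda>x. x * (std_normal_density (normal_max_threshold z x) / normal_max_threshold z x)) \<longlongrightarrow> exp (- z)) at_top"
proof -
  let ?T = "normal_max_threshold z"
  define s :: "real \<Rightarrow> real" where "s x = sqrt (2 * ln x)" for x
  define w where "w x = z - (ln (ln x) + ln (4 * pi)) / 2" for x
  have 1: "((\<lambda>x. s x / ?T x) \<longlongrightarrow> 1) at_top"
    unfolding s_def normal_max_threshold_def by real_asymp
  have 2: "((\<lambda>x. w x / s x) \<longlongrightarrow> 0) at_top"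
    unfolding s_def w_def by real_asymp
  have "((\<lambda>x. exp (- z) * (s x / ?T x) * exp (- (w x / s x)\<^sup>2 / 2)) \<longlongrightarrow> exp (- z) * 1 * exp (- 0\<^sup>2 / 2)) at_top"
    by (intro tendsto_intros 1 2) auto
  then have lim: "((\<lambda>x. exp (- z) * (s x / ?T x) * exp (- (w x / s x)\<^sup>2 / 2)) \<longlongrightarrow> exp (- z)) at_top"
    by simp
  have "\<forall>\<^sub>F x in at_top. exp (- z) * (s x / ?T x) * exp (- (w x / s x)\<^sup>2 / 2) = x * (std_normal_density (?T x) / ?T x)"
  proof (rule eventually_mono[OF eventually_gt_at_top[of 1]])
    fix x :: real assume x: "1 < x"
    then have L: "0 < ln x" and s0: "0 < s x" by (auto simp: s_def)
    have s2: "(s x)\<^sup>2 = 2 * ln x" using L by (simp add: s_def)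
    have T: "?T x = s x + w x / s x"
      unfolding normal_max_threshold_def s_def[symmetric] w_def using s0 by (simp add: field_simps)
    have "(?T x)\<^sup>2 = 2 * ln x + 2 * w x + (w x / s x)\<^sup>2"
      unfolding T power2_sum s2[symmetric] using s0 by simp
    then have "x * exp (- (?T x)\<^sup>2 / 2) = x * exp (- ln x + - w x + - (w x / s x)\<^sup>2 / 2)"
      by (simp add: add_divide_distrib)
    also have "\<dots> = exp (- w x) * exp (- (w x / s x)\<^sup>2 / 2)"
      unfolding exp_add using x by (simp add: exp_minus)
    also have "exp (- w x) = exp (- z) * sqrt (ln x * (4 * pi))"
    proof -
      have "exp ((ln (ln x) + ln (4 * pi)) / 2) = sqrt (ln x * (4 * pi))"
      proof (rule real_sqrt_unique[symmetric])
        have "(exp ((ln (ln x) + ln (4 * pi)) / 2))\<^sup>2 = exp (ln (ln x) + ln (4 * pi))"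
          by (simp add: power2_eq_square exp_add[symmetric])
        also have "\<dots> = ln x * (4 * pi)" using L by (simp add: exp_add)
        finally show "(exp ((ln (ln x) + ln (4 * pi)) / 2))\<^sup>2 = ln x * (4 * pi)" .
      qed simp
      moreover have "- w x = - z + (ln (ln x) + ln (4 * pi)) / 2" by (simp add: w_def)
      ultimately show ?thesis by (simp only: exp_add)
    qed
    also have "sqrt (ln x * (4 * pi)) = s x * sqrt (2 * pi)"
      unfolding s_def real_sqrt_mult[symmetric] by (simp add: ac_simps)
    finally have "x * exp (- (?T x)\<^sup>2 / 2) = exp (- z) * (s x * sqrt (2 * pi)) * exp (- (w x / s x)\<^sup>2 / 2)" .
    moreover have "x * (std_normal_density (?T x) / ?T x) = (x * exp (- (?T x)\<^sup>2 / 2)) / (sqrt (2 * pi) * ?T x)"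
      unfolding std_normal_density_def by simp
    ultimately have "x * (std_normal_density (?T x) / ?T x) =
        exp (- z) * (s x * sqrt (2 * pi)) * exp (- (w x / s x)\<^sup>2 / 2) / (sqrt (2 * pi) * ?T x)"
      by (simp only:)
    then show "exp (- z) * (s x / ?T x) * exp (- (w x / s x)\<^sup>2 / 2) = x * (std_normal_density (?T x) / ?T x)"
      by (auto simp: mult.assoc)
  qed
  from tendsto_cong[OF this] lim show ?thesis by simp
qed

lemma threshold_square_ratio: "((\<lambda>x. (normal_max_threshold z x)\<^sup>2 / ln x) \<longlongrightarrow> 2) at_top"
  unfolding normal_max_threshold_def by real_asymp (simp add: powr_half_sqrt)

text \<open>The Mills ratio bounds squeeze the tail between two multiples of density over threshold
  whose quotient tends to 1.\<close>

lemma tail_at_threshold: "((\<lambda>x. x * measure gauss {normal_max_threshold z x<..}) \<longlongrightarrow> exp (- z)) at_top"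
proof -
  let ?T = "normal_max_threshold z"
  let ?f = "\<lambda>x. x * (std_normal_density (?T x) / ?T x)"
  have "((\<lambda>x. 1 + 1 / (?T x)\<^sup>2) \<longlongrightarrow> 1) at_top"
    unfolding normal_max_threshold_def by real_asymp
  from tendsto_divide[OF density_at_threshold this]
  have lower: "((\<lambda>x. ?f x / (1 + 1 / (?T x)\<^sup>2)) \<longlongrightarrow> exp (- z)) at_top" by simp
  have ev: "\<forall>\<^sub>F x in at_top. 0 < ?T x \<and> 0 \<le> x"
    using normal_max_threshold_at_top[of z] eventually_ge_at_top[of "0::real"]
    by (auto simp: filterlim_at_top_dense intro: eventually_conj)
  show ?thesis
  proof (rule tendsto_sandwich[OF _ _ lower density_at_threshold])
    show "\<forall>\<^sub>F x in at_top. ?f x / (1 + 1 / (?T x)\<^sup>2) \<le> x * measure gauss {?T x<..}"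
    proof (rule eventually_mono[OF ev])
      fix x assume x: "0 < ?T x \<and> 0 \<le> x"
      have pos: "0 < 1 + 1 / (?T x)\<^sup>2" by (rule add_pos_nonneg) auto
      have "?f x \<le> x * ((1 + 1 / (?T x)\<^sup>2) * measure gauss {?T x<..})"
        using x by (intro mult_left_mono mills_ratio) auto
      then show "?f x / (1 + 1 / (?T x)\<^sup>2) \<le> x * measure gauss {?T x<..}"
        using pos by (simp only: pos_divide_le_eq ac_simps)
    qed
    show "\<forall>\<^sub>F x in at_top. x * measure gauss {?T x<..} \<le> ?f x"
      by (rule eventually_mono[OF ev]) (intro mult_left_mono mills_ratio, auto)
  qed
qed

text \<open>The squared threshold is asymptotically \<open>2 * ln x\<close>, so the exponential is
  \<open>x\<close> to the power \<open>- 2 * k + o(1)\<close>.\<close>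

lemma powr_exp_threshold:
  assumes "p < 2 * k"
  shows "((\<lambda>x. x powr p * exp (- k * (normal_max_threshold z x)\<^sup>2)) \<longlongrightarrow> 0) at_top"
proof -
  let ?T = "normal_max_threshold z"
  have "((\<lambda>x. p - k * ((?T x)\<^sup>2 / ln x)) \<longlongrightarrow> p - k * 2) at_top"
    by (intro tendsto_intros threshold_square_ratio)
  moreover have "p - k * 2 < 0" using assms by simp
  ultimately have "filterlim (\<lambda>x. (p - k * ((?T x)\<^sup>2 / ln x)) * ln x) at_bot at_top"
    by (rule filterlim_tendsto_neg_mult_at_bot[OF _ _ ln_at_top])
  then have lim: "((\<lambda>x. exp ((p - k * ((?T x)\<^sup>2 / ln x)) * ln x)) \<longlongrightarrow> 0) at_top"
    by (rule filterlim_compose[OF exp_at_bot])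
  have "\<forall>\<^sub>F x in at_top. exp ((p - k * ((?T x)\<^sup>2 / ln x)) * ln x) = x powr p * exp (- k * (?T x)\<^sup>2)"
    by (rule eventually_mono[OF eventually_gt_at_top[of 1]])
      (simp add: powr_def exp_add[symmetric] left_diff_distrib)
  from tendsto_cong[OF this] lim show ?thesis by simp
qed

section \<open>Frames\<close>

text \<open>A homogeneous linear system with fewer equations than unknowns has a nonzero solution;
  the induction is Gaussian elimination on the equations.\<close>

lemma exists_orthogonal_vector:
  assumes "finite \<Omega>" "finite I" "card \<Omega> < card I"
  shows "\<exists>u. (\<exists>i\<in>I. u i \<noteq> 0) \<and> (\<forall>\<omega>\<in>\<Omega>. dot I (\<phi> \<omega>) u = 0)"
  using assms
proof (induction \<Omega> arbitrary: I \<phi> rule: finite_induct)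
  case empty
  then have "I \<noteq> {}" by auto
  then show ?case by (intro exI[of _ "\<lambda>_. 1"]) auto
next
  case (insert \<omega> \<Omega>)
  show ?case
  proof (cases "\<forall>i\<in>I. \<phi> \<omega> i = 0")
    case True
    then have "dot I (\<phi> \<omega>) u = 0" for u by (simp add: dot_def)
    then show ?thesis using insert.IH[of I \<phi>] insert by auto
  next
    case False
    then obtain i where i: "i \<in> I" "\<phi> \<omega> i \<noteq> 0" by blast
    let ?I = "I - {i}"
    \<comment> \<open>Subtracting a multiple of the pivot row \<open>\<phi> \<omega>\<close> removes
      the unknown \<open>i\<close> from the other equations.\<close>
    define \<psi> where "\<psi> \<omega>' j = \<phi> \<omega>' j - \<phi> \<omega>' i / \<phi> \<omega> i * \<phi> \<omega> j" for \<omega>' j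
    have "\<exists>u. (\<exists>j\<in>?I. u j \<noteq> 0) \<and> (\<forall>\<omega>'\<in>\<Omega>. dot ?I (\<psi> \<omega>') u = 0)"
      using insert i by (intro insert.IH) auto
    then obtain u j where j: "j \<in> ?I" "u j \<noteq> 0" and u: "\<And>\<omega>'. \<omega>' \<in> \<Omega> \<Longrightarrow> dot ?I (\<psi> \<omega>') u = 0" by blast
    \<comment> \<open>The value at \<open>i\<close> is chosen to solve the pivot equation.\<close>
    define v where "v = u(i := - dot ?I (\<phi> \<omega>) u / \<phi> \<omega> i)"
    have v: "dot I f v = - f i * dot ?I (\<phi> \<omega>) u / \<phi> \<omega> i + dot ?I f u" for f
    proof -
      have "dot I f v = f i * v i + dot ?I f v"
        using insert i unfolding dot_def by (simp add: sum.remove)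
      also have "dot ?I f v = dot ?I f u" unfolding dot_def v_def by (rule sum.cong) auto
      finally have "dot I f v = f i * v i + dot ?I f u" .
      moreover have "v i = - dot ?I (\<phi> \<omega>) u / \<phi> \<omega> i" by (simp add: v_def)
      ultimately show ?thesis by simp
    qed
    have "dot I (\<phi> \<omega>') v = 0" if "\<omega>' \<in> insert \<omega> \<Omega>" for \<omega>'
    proof (cases "\<omega>' = \<omega>")
      case True
      then show ?thesis using i by (simp add: v)
    next
      case False
      then have "dot ?I (\<psi> \<omega>') u = 0" using that u by auto
      then show ?thesis unfolding v \<psi>_def dot_diff_left dot_scale_left by simp
    qed
    moreover have "v j \<noteq> 0" using j by (simp add: v_def)
    ultimately show ?thesis using j by blast
  qed
qed

lemma dot_self: "dot I v v = (L2_set v I)\<^sup>2"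
  by (simp add: dot_def L2_set_def sum_nonneg power2_eq_square)

text \<open>A nonzero vector orthogonal to all frame elements would contradict the lower frame
  inequality. This is what makes the number of elements tend to infinity.\<close>

lemma frame_card_ge:
  assumes "is_frame I \<Omega> \<phi>" "finite I"
  shows "card I \<le> card \<Omega>"
proof (rule ccontr)
  assume "\<not> card I \<le> card \<Omega>"
  moreover obtain a b where f: "frame_constants I \<Omega> \<phi> a b" and "finite \<Omega>"
    using assms unfolding is_frame_def by blast
  ultimately obtain u i where i: "i \<in> I" "u i \<noteq> 0" and u: "\<And>\<omega>. \<omega> \<in> \<Omega> \<Longrightarrow> dot I (\<phi> \<omega>) u = 0"
    using exists_orthogonal_vector[of \<Omega> I \<phi>] assms by auto
  have "a * (L2_set u I)\<^sup>2 \<le> (\<Sum>\<omega>\<in>\<Omega>. \<bar>dot I (\<phi> \<omega>) u\<bar>\<^sup>2)" and a: "0 < a"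
    using f unfolding frame_constants_def by blast+
  then have "a * (L2_set u I)\<^sup>2 \<le> 0" using u by simp
  then have "dot I u u \<le> 0" using a by (simp add: dot_self mult_le_0_iff)
  moreover have "0 < dot I u u"
    unfolding dot_def using i assms(2) by (intro sum_pos2[of I i]) (auto simp: zero_less_mult_iff linorder_neq_iff)
  ultimately show False by simp
qed

section \<open>Removal of the strongly correlated elements\<close>

text \<open>The maxima over \<open>\<Omega>\<close> and over \<open>\<Omega> - B\<close> stay below
  \<open>u\<close> together unless some element of \<open>B\<close> exceeds \<open>u\<close>, which
  a union bound estimates. On \<open>\<Omega> - B\<close> all correlations of distinct elements are
  at most \<open>\<rho>\<close>.\<close>

lemma std_gauss_max_approximation_discard:
  fixes u b \<rho> :: real
  assumes I: "finite I" and \<Omega>: "finite \<Omega>" and unit: "\<And>\<omega>. \<omega> \<in> \<Omega> \<Longrightarrow> dot I (\<phi> \<omega>) (\<phi> \<omega>) = 1"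
    and \<rho>: "\<rho> \<le> 1" and b: "0 \<le> b" "\<And>\<omega>. \<omega> \<in> \<Omega> \<Longrightarrow> (\<Sum>\<omega>'\<in>\<Omega>. (dot I (\<phi> \<omega>) (\<phi> \<omega>'))\<^sup>2) \<le> b"
    and u: "20 \<le> u"
  defines "B \<equiv> {\<omega> \<in> \<Omega>. \<exists>\<omega>'\<in>\<Omega>. \<omega> \<noteq> \<omega>' \<and> \<rho> \<le> \<bar>dot I (\<phi> \<omega>) (\<phi> \<omega>')\<bar>}"
  shows "\<bar>measure (std_gauss I) {x \<in> space (std_gauss I). \<forall>\<omega>\<in>\<Omega>. dot I (\<phi> \<omega>) x \<le> u} -
      exp (- ((real (card \<Omega>) - card B) * measure gauss {u<..}))\<bar>
    \<le> card B * measure gauss {u<..} + (card \<Omega> * exp (- u\<^sup>2) + 4 * real (card \<Omega>) * sqrt (card \<Omega> * b) * exp (- (4/5) * u\<^sup>2)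
      + 256 * real (card \<Omega>) * b * exp (- (u\<^sup>2 / (1 + \<rho>))))"
proof -
  interpret S: prob_space "std_gauss I" by (rule prob_space_std_gauss)
  note [simp] = I
  let ?E = "\<lambda>J. {x \<in> space (std_gauss I). \<forall>\<omega>\<in>J. dot I (\<phi> \<omega>) x \<le> u}"
  let ?A = "\<lambda>\<omega>. {x \<in> space (std_gauss I). u < dot I (\<phi> \<omega>) x}"
  define J where "J = \<Omega> - B"
  have BO: "B \<subseteq> \<Omega>" and JO: "J \<subseteq> \<Omega>" unfolding B_def J_def by auto
  have fin [simp]: "finite B" "finite J" using BO JO \<Omega> by (auto intro: finite_subset)
  have cJ: "real (card J) = real (card \<Omega>) - card B"
    unfolding J_def using BO \<Omega> by (simp add: card_Diff_subset of_nat_diff card_mono)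
  have cJO: "card J \<le> card \<Omega>" using JO \<Omega> by (intro card_mono)
  have E [measurable]: "?E K \<in> S.events" if [simp]: "finite K" for K by measurable
  have A [measurable]: "?A \<omega> \<in> S.events" for \<omega> by measurable
  have "S.prob (?E J) \<le> S.prob (?E \<Omega> \<union> (\<Union>\<omega>\<in>B. ?A \<omega>))"
  proof (rule S.finite_measure_mono)
    show "?E J \<subseteq> ?E \<Omega> \<union> (\<Union>\<omega>\<in>B. ?A \<omega>)" unfolding J_def by (auto simp: not_less)
    show "?E \<Omega> \<union> (\<Union>\<omega>\<in>B. ?A \<omega>) \<in> S.events"
      by (intro sets.Un E \<Omega> sets.finite_UN A fin)
  qed
  also have "\<dots> \<le> S.prob (?E \<Omega>) + S.prob (\<Union>\<omega>\<in>B. ?A \<omega>)"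
    by (intro measure_Un_le E \<Omega> sets.finite_UN A fin)
  also have "S.prob (\<Union>\<omega>\<in>B. ?A \<omega>) \<le> (\<Sum>\<omega>\<in>B. S.prob (?A \<omega>))"
    by (rule S.finite_measure_subadditive_finite) (use A in \<open>auto simp del: sets_std_gauss\<close>)
  also have "(\<Sum>\<omega>\<in>B. S.prob (?A \<omega>)) = card B * measure gauss {u<..}"
    using BO unit by (simp add: measure_dot_unit subset_iff)
  finally have 1: "S.prob (?E J) \<le> S.prob (?E \<Omega>) + card B * measure gauss {u<..}" by simp
  have 2: "S.prob (?E \<Omega>) \<le> S.prob (?E J)"
    by (rule S.finite_measure_mono[OF _ E]) (use JO in auto)
  have "\<bar>S.prob (?E J) - exp (- (card J * measure gauss {u<..}))\<bar>
    \<le> card J * exp (- u\<^sup>2) + 4 * real (card J) * sqrt (card J * b) * exp (- (4/5) * u\<^sup>2)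
      + 256 * real (card J) * b * exp (- (u\<^sup>2 / (1 + \<rho>)))"
  proof (rule std_gauss_max_approximation[OF I _ _ _ \<rho> _ u])
    show "\<bar>dot I (\<phi> i) (\<phi> j)\<bar> \<le> \<rho>" if "i \<in> J" "j \<in> J" "i \<noteq> j" for i j
      using that unfolding J_def B_def by force
    show "(\<Sum>j\<in>J. (dot I (\<phi> i) (\<phi> j))\<^sup>2) \<le> b" if "i \<in> J" for i
      using b(2)[of i] that JO by (intro order.trans[OF sum_mono2[OF \<Omega> JO]]) auto
  qed (use JO unit in auto)
  also have "\<dots> \<le> card \<Omega> * exp (- u\<^sup>2) + 4 * real (card \<Omega>) * sqrt (card \<Omega> * b) * exp (- (4/5) * u\<^sup>2)
      + 256 * real (card \<Omega>) * b * exp (- (u\<^sup>2 / (1 + \<rho>)))"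
    using cJO b(1) by (intro add_mono mult_mono real_sqrt_le_mono) auto
  finally show ?thesis unfolding cJ using 1 2 by linarith
qed

section \<open>Law of the noise vector\<close>

text \<open>Independence makes the joint law the product of the marginal laws. The restriction to
  \<open>I\<close> is required for values in the product space and does not affect inner products
  over \<open>I\<close>.\<close>

lemma (in prob_space) distr_standard_normal_vector:
  assumes X: "standard_normal_vector M I X" and I: "finite I" "I \<noteq> {}"
  shows "(\<lambda>x. \<lambda>i\<in>I. X x i) \<in> M \<rightarrow>\<^sub>M PiM I (\<lambda>_. borel)"
    and "distr M (PiM I (\<lambda>_. borel)) (\<lambda>x. \<lambda>i\<in>I. X x i) = std_gauss I"
proof -
  have rv: "(\<lambda>x. X x i) \<in> borel_measurable M" if "i \<in> I" for i
    using X that unfolding standard_normal_vector_def by (auto simp: indep_vars_def)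
  then show "(\<lambda>x. \<lambda>i\<in>I. X x i) \<in> M \<rightarrow>\<^sub>M PiM I (\<lambda>_. borel)" by measurable
  have law: "distr M borel (\<lambda>x. X x i) = gauss" if "i \<in> I" for i
  proof -
    have "distr M lborel (\<lambda>x. X x i) = gauss"
      using X that unfolding standard_normal_vector_def by (auto dest: distributed_distr_eq_density)
    moreover have "distr M lborel (\<lambda>x. X x i) = distr M borel (\<lambda>x. X x i)"
      by (rule distr_cong) auto
    ultimately show ?thesis by simp
  qed
  have "distr M (PiM I (\<lambda>_. borel)) (\<lambda>x. \<lambda>i\<in>I. X x i) = PiM I (\<lambda>i. distr M borel (\<lambda>x. X x i))"
    using X indep_vars_iff_distr_eq_PiM'[OF I(2), where M' = "\<lambda>_. borel" and X = "\<lambda>i x. X x i"] rv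
    unfolding standard_normal_vector_def by simp
  also have "\<dots> = std_gauss I"
    unfolding std_gauss_def by (rule PiM_cong) (auto simp: law)
  finally show "distr M (PiM I (\<lambda>_. borel)) (\<lambda>x. \<lambda>i\<in>I. X x i) = std_gauss I" .
qed

lemma dot_restrict: "dot I v (\<lambda>i\<in>I. f i) = dot I v f"
  unfolding dot_def by (rule sum.cong) auto

lemma finite_grid: "finite (grid d n)"
  unfolding grid_def by (intro finite_PiE) auto

lemma card_grid: "card (grid d n) = n ^ d"
  unfolding grid_def by (subst card_PiE) auto

lemma normal_max_threshold_card:
  "normal_max_scale m * z + normal_max_location m = normal_max_threshold z (real m)"
  by (simp add: normal_max_scale_def normal_max_location_def normal_max_threshold_def)

section \<open>Gumbel limit of the frame coefficients\<close>

theorem theorem3p3: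
  fixes d :: nat
    and \<Omega> :: "nat \<Rightarrow> 'w set"
    and \<phi> :: "nat \<Rightarrow> 'w \<Rightarrow> (nat \<Rightarrow> nat) \<Rightarrow> real"
    and M :: "'a measure"
    and \<epsilon> :: "nat \<Rightarrow> 'a \<Rightarrow> (nat \<Rightarrow> nat) \<Rightarrow> real"
  assumes "d \<ge> 1"
    and "asymptotically_stable d \<Omega> \<phi>"
    and "prob_space M"
    and "\<And>n. n \<ge> 1 \<Longrightarrow> standard_normal_vector M (grid d n) (\<epsilon> n)"
  shows "gumbel_type M (\<lambda>n x. Max ((\<lambda>\<omega>. dot (grid d n) (\<phi> n \<omega>) (\<epsilon> n x)) ` \<Omega> n))
           (\<lambda>n. normal_max_scale (card (\<Omega> n))) (\<lambda>n. normal_max_location (card (\<Omega> n)))"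
proof -
  interpret prob_space M by fact
  let ?I = "grid d" and ?N = "\<lambda>n. real (card (\<Omega> n))"
  let ?X = "\<lambda>n x. Max ((\<lambda>\<omega>. dot (?I n) (\<phi> n \<omega>) (\<epsilon> n x)) ` \<Omega> n)"
  have frame: "is_frame (?I n) (\<Omega> n) (\<phi> n)" if "n \<ge> 1" for n
    using assms(2) that unfolding asymptotically_stable_def by blast
  have unit: "dot (?I n) (\<phi> n \<omega>) (\<phi> n \<omega>) = 1" if "n \<ge> 1" "\<omega> \<in> \<Omega> n" for n \<omega>
    using assms(2) that unfolding asymptotically_stable_def dot_self by simp
  have fin: "finite (\<Omega> n)" if "n \<ge> 1" for n using frame[OF that] unfolding is_frame_def by blast
  \<comment> \<open>The hypothesis \<open>d \<ge> 1\<close> enters here, through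
    \<open>n \<le> n ^ d\<close>.\<close>
  have cardI: "n \<le> card (?I n)" for n
    unfolding card_grid using assms(1) by (cases "n = 0") (auto intro: self_le_power)
  have I_ne: "?I n \<noteq> {}" if "n \<ge> 1" for n using cardI[of n] that by force
  have N_ge: "n \<le> card (\<Omega> n)" if "n \<ge> 1" for n
    using frame_card_ge[OF frame[OF that] finite_grid] cardI[of n] by simp
  have N_top: "filterlim ?N at_top sequentially"
    by (rule filterlim_at_top_mono[OF filterlim_real_sequentially])
      (use N_ge in \<open>auto simp: eventually_sequentially intro!: exI[of _ 1]\<close>)
  obtain \<rho> where \<rho>: "0 < \<rho>" "\<rho> < 1" and pairs: "(\<lambda>n. real (card {(\<omega>, \<omega>'). \<omega> \<in> \<Omega> n \<and> \<omega>' \<in> \<Omega> n \<and> \<omega> \<noteq> \<omega>' \<and>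
        \<bar>dot (?I n) (\<phi> n \<omega>) (\<phi> n \<omega>')\<bar> \<ge> \<rho>})) \<in> o(\<lambda>n. ?N n / sqrt (ln (?N n)))"
    using assms(2) unfolding asymptotically_stable_def by blast
  have "bdd_above ((\<lambda>n. upper_frame_bound (?I n) (\<Omega> n) (\<phi> n)) ` {1..})"
    using assms(2) unfolding asymptotically_stable_def by (elim conjE)
  then obtain b0 where b0: "\<And>n. n \<ge> 1 \<Longrightarrow> upper_frame_bound (?I n) (\<Omega> n) (\<phi> n) \<le> b0"
    unfolding bdd_above_def by (meson atLeast_iff imageI)
  define b where "b = max 0 b0"
  \<comment> \<open>The upper frame inequality is applied to the frame element itself, a unit
    vector; this bounds each row of the Gram matrix in square sum.\<close>
  have gram: "(\<Sum>\<omega>'\<in>\<Omega> n. (dot (?I n) (\<phi> n \<omega>) (\<phi> n \<omega>'))\<^sup>2) \<le> b" if n: "n \<ge> 1" and \<omega>: "\<omega> \<in> \<Omega> n" for n \<omega>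
  proof -
    obtain a where "frame_constants (?I n) (\<Omega> n) (\<phi> n) a (upper_frame_bound (?I n) (\<Omega> n) (\<phi> n))"
      using upper_frame_bound(1)[OF frame[OF n] finite_grid I_ne[OF n]] by blast
    then have "(\<Sum>\<omega>'\<in>\<Omega> n. \<bar>dot (?I n) (\<phi> n \<omega>') (\<phi> n \<omega>)\<bar>\<^sup>2) \<le> upper_frame_bound (?I n) (\<Omega> n) (\<phi> n) * (L2_set (\<phi> n \<omega>) (?I n))\<^sup>2"
      unfolding frame_constants_def by blast
    then show ?thesis
      using b0[OF n] unit[OF n \<omega>] by (simp add: dot_self b_def dot_commute[of _ "\<phi> n \<omega>"])
  qed
  define B where "B n = {\<omega> \<in> \<Omega> n. \<exists>\<omega>'\<in>\<Omega> n. \<omega> \<noteq> \<omega>' \<and> \<rho> \<le> \<bar>dot (?I n) (\<phi> n \<omega>) (\<phi> n \<omega>')\<bar>}" for n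
  have B_small: "(\<lambda>n. card (B n) / ?N n) \<longlonglongrightarrow> 0"
  proof -
    let ?P = "\<lambda>n. {(\<omega>, \<omega>'). \<omega> \<in> \<Omega> n \<and> \<omega>' \<in> \<Omega> n \<and> \<omega> \<noteq> \<omega>' \<and> \<rho> \<le> \<bar>dot (?I n) (\<phi> n \<omega>) (\<phi> n \<omega>')\<bar>}"
    have BP: "card (B n) \<le> card (?P n)" if "n \<ge> 1" for n
    proof -
      \<comment> \<open>Every discarded element is the first component of a strongly correlated
        pair.\<close>
      have "B n \<subseteq> fst ` ?P n" unfolding B_def by force
      moreover have "finite (?P n)"
        by (rule finite_subset[of _ "\<Omega> n \<times> \<Omega> n"]) (use fin[OF that] in auto)
      ultimately show ?thesis by (meson card_image_le card_mono finite_imageI order_trans)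
    qed
    \<comment> \<open>Once \<open>ln N \<ge> 1\<close>, the rate in the stability condition is at
      most \<open>N\<close>, so the discarded elements number \<open>o(N)\<close>.\<close>
    have "(\<lambda>n. ?N n / sqrt (ln (?N n))) \<in> O(?N)"
    proof (rule bigoI[of _ 1])
      have "\<forall>\<^sub>F n in sequentially. exp 1 \<le> ?N n" using N_top unfolding filterlim_at_top by blast
      then show "\<forall>\<^sub>F n in sequentially. norm (?N n / sqrt (ln (?N n))) \<le> 1 * norm (?N n)"
      proof eventually_elim
        case (elim n)
        have "0 < ?N n" using less_le_trans[OF exp_gt_zero elim] .
        then have "1 \<le> ln (?N n)" using elim by (subst ln_ge_iff)
        then have "?N n / sqrt (ln (?N n)) \<le> ?N n / 1" by (intro divide_left_mono) auto
        then show ?case using \<open>1 \<le> ln (?N n)\<close> by simp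
      qed
    qed
    with pairs have "(\<lambda>n. real (card (?P n))) \<in> o(?N)" by (rule landau_o.small_big_trans)
    then have P: "(\<lambda>n. card (?P n) / ?N n) \<longlonglongrightarrow> 0" by (rule smalloD_tendsto)
    show ?thesis
      by (rule tendsto_sandwich[OF _ _ tendsto_const P])
        (use BP in \<open>auto simp: eventually_sequentially intro!: exI[of _ 1] divide_right_mono\<close>)
  qed
  have Xm: "(\<lambda>x. dot (?I n) (\<phi> n \<omega>) (\<epsilon> n x)) \<in> borel_measurable M" if "n \<ge> 1" for n \<omega>
  proof -
    note [simp] = finite_grid
    note [measurable] = distr_standard_normal_vector(1)[OF assms(4)[OF that] finite_grid I_ne[OF that]]
    have "(\<lambda>x. dot (?I n) (\<phi> n \<omega>) (\<lambda>i\<in>?I n. \<epsilon> n x i)) \<in> borel_measurable M" by measurable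
    then show ?thesis by (simp add: dot_restrict)
  qed
  \<comment> \<open>The maximum over a nonempty finite set is at most \<open>u\<close> iff all inner
    products are, and these depend only on the noise restricted to the grid.\<close>
  have law: "measure M {x \<in> space M. ?X n x \<le> u} =
      measure (std_gauss (?I n)) {x \<in> space (std_gauss (?I n)). \<forall>\<omega>\<in>\<Omega> n. dot (?I n) (\<phi> n \<omega>) x \<le> u}" (is "_ = measure _ ?E")
    if n: "n \<ge> 1" for n u
  proof -
    note [simp] = finite_grid fin[OF n]
    note D = distr_standard_normal_vector[OF assms(4)[OF n] finite_grid I_ne[OF n]]
    have E: "?E \<in> sets (PiM (?I n) (\<lambda>_. borel))"
      unfolding sets_std_gauss[symmetric] by measurable
    have ne: "\<Omega> n \<noteq> {}" using N_ge[OF n] n by auto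
    have "measure (std_gauss (?I n)) ?E = measure M ((\<lambda>x. \<lambda>i\<in>?I n. \<epsilon> n x i) -` ?E \<inter> space M)"
      unfolding D(2)[symmetric] by (rule measure_distr[OF D(1)]) (use E D(2) in simp)
    also have "(\<lambda>x. \<lambda>i\<in>?I n. \<epsilon> n x i) -` ?E \<inter> space M = {x \<in> space M. ?X n x \<le> u}"
      using ne by (auto simp: space_std_gauss dot_restrict Max_le_iff)
    finally show ?thesis ..
  qed
  have lim: "(\<lambda>n. measure M {x \<in> space M. ?X n x \<le> normal_max_threshold z (?N n)}) \<longlonglongrightarrow> exp (- exp (- z))" for z
  proof -
    let ?T = "\<lambda>n. normal_max_threshold z (?N n)"
    define p where "p n = measure gauss {?T n<..}" for n
    define err where "err n = card (B n) * p n + (?N n * exp (- (?T n)\<^sup>2) + 4 * ?N n * sqrt (?N n * b) * exp (- (4/5) * (?T n)\<^sup>2)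
      + 256 * ?N n * b * exp (- ((?T n)\<^sup>2 / (1 + \<rho>))))" for n
    have Np: "(\<lambda>n. ?N n * p n) \<longlonglongrightarrow> exp (- z)"
      unfolding p_def by (rule filterlim_compose[OF tail_at_threshold N_top])
    have N1: "\<forall>\<^sub>F n in sequentially. 1 \<le> ?N n" using N_top unfolding filterlim_at_top by blast
    have Bp: "(\<lambda>n. card (B n) * p n) \<longlonglongrightarrow> 0"
    proof -
      \<comment> \<open>The proportion of discarded elements tends to 0, while \<open>N * p\<close>
        stays bounded.\<close>
      have "(\<lambda>n. card (B n) / ?N n * (?N n * p n)) \<longlonglongrightarrow> 0 * exp (- z)"
        by (intro tendsto_mult B_small Np)
      moreover have "\<forall>\<^sub>F n in sequentially. card (B n) / ?N n * (?N n * p n) = card (B n) * p n"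
        using N1 by eventually_elim auto
      ultimately show ?thesis using tendsto_cong by fastforce
    qed
    have main: "(\<lambda>n. exp (- ((?N n - card (B n)) * p n))) \<longlonglongrightarrow> exp (- (exp (- z) - 0))"
      unfolding left_diff_distrib by (intro tendsto_intros Np Bp)
    have pe: "(\<lambda>n. ?N n powr q * exp (- k * (?T n)\<^sup>2)) \<longlonglongrightarrow> 0" if "q < 2 * k" for q k
      by (rule filterlim_compose[OF powr_exp_threshold[OF that] N_top])
    \<comment> \<open>The error terms in powers of \<open>N\<close>: the comparisons are
      \<open>1 < 2\<close>, \<open>3/2 < 8/5\<close> and \<open>1 < 2 / (1 + \<rho>)\<close>, the
      last by \<open>\<rho> < 1\<close>. The power 3/2 is \<open>N * sqrt N\<close> from the
      Cauchy-Schwarz term.\<close>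
    have "(\<lambda>n. card (B n) * p n + (?N n powr 1 * exp (- 1 * (?T n)\<^sup>2) + 4 * sqrt b * (?N n powr (3/2) * exp (- (4/5) * (?T n)\<^sup>2))
      + 256 * b * (?N n powr 1 * exp (- (1 / (1 + \<rho>)) * (?T n)\<^sup>2)))) \<longlonglongrightarrow> 0 + (0 + 4 * sqrt b * 0 + 256 * b * 0)"
      by (intro tendsto_add tendsto_mult tendsto_const pe Bp) (use \<rho> in \<open>auto simp: field_simps\<close>)
    moreover have "\<forall>\<^sub>F n in sequentially. card (B n) * p n + (?N n powr 1 * exp (- 1 * (?T n)\<^sup>2) + 4 * sqrt b * (?N n powr (3/2) * exp (- (4/5) * (?T n)\<^sup>2))
      + 256 * b * (?N n powr 1 * exp (- (1 / (1 + \<rho>)) * (?T n)\<^sup>2))) = err n"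
      using N1
    proof eventually_elim
      case (elim n)
      have "?N n powr (3/2) = ?N n powr (1 + 1/2)" by simp
      also have "\<dots> = ?N n * sqrt (?N n)" unfolding powr_add using elim by (simp add: powr_half_sqrt)
      finally show ?case using elim by (simp add: err_def real_sqrt_mult)
    qed
    ultimately have err: "err \<longlonglongrightarrow> 0" using tendsto_cong by fastforce
    \<comment> \<open>The estimates for small correlations are available from threshold 20
      on.\<close>
    have T20: "\<forall>\<^sub>F n in sequentially. 20 \<le> ?T n"
      using filterlim_compose[OF normal_max_threshold_at_top N_top] by (simp add: filterlim_at_top)
    have "\<forall>\<^sub>F n in sequentially. norm (measure M {x \<in> space M. ?X n x \<le> ?T n} - exp (- ((?N n - card (B n)) * p n))) \<le> err n"
      using T20 eventually_ge_at_top[of 1]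
    proof eventually_elim
      case (elim n)
      note n = \<open>n \<ge> 1\<close>
      show ?case
        unfolding law[OF n] err_def p_def B_def real_norm_def
      proof (rule std_gauss_max_approximation_discard)
        show "finite (?I n)" by (rule finite_grid)
      qed (use fin[OF n] unit[OF n] gram[OF n] elim \<rho> in \<open>auto simp: b_def\<close>)
    qed
    then have "(\<lambda>n. measure M {x \<in> space M. ?X n x \<le> ?T n} - exp (- ((?N n - card (B n)) * p n))) \<longlonglongrightarrow> 0"
      using err by (rule Lim_null_comparison)
    from tendsto_add[OF this main] show ?thesis by simp
  qed
  show ?thesis
    unfolding gumbel_type_def normal_max_threshold_card
    using lim Xm fin by (auto intro!: borel_measurable_Max)
qed

end
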